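(* Let $G=(V,E)$ be a graph and $d \geq 2$ an integer. Then $E$ is independent in the generic $d$-parallel matroid (that is, $E$ is $d$-parallel independent) if and only if the polynomial in $q$ $$([d]_q-1)^{\mathbf{v}(G)-\mathbf{c}(G)} \, \mathbf{T}_G\!\left(\frac{[2]_q\,[d]_q}{[d]_q-1},\,[d]_q\right)$$ is monic of degree $d(\mathbf{v}(G)-\mathbf{c}(G))$.
   Context: A graph $G=(V,E)$ consists of a finite nonempty set $V$ of vertices and a finite set $E$ of edges; each edge has two endpoints in $V$, not necessarily distinct. An edge whose endpoints coincide is a loop; parallel edges are allowed. $\mathbf{v}(G)$ and $\mathbf{c}(G)$ denote the numbers of vertices and of connected components of $G$. For a positive integer $m$, $[m]_q=(1-q^m)/(1-q)=1+q+\dots+q^{m-1}$. Tutte polynomial: for $F\subset E$ let $r(F)$ be the cardinality of a maximal acyclic subset of $F$. Then $\mathbf{T}_G(x,y)=\sum_{F\subset E}(x-1)^{r(E)-r(F)}(y-1)^{|F|-r(F)}$. Since $r(E)=\mathbf{v}(G)-\mathbf{c}(G)$, the displayed expression in the claim is a polynomial in $q$. $d$-parallel independence: a picture of $G$ in $\mathbb{P}^d=\mathbb{P}^d_{\mathbb{C}}$ assigns to each vertex $v$ a point $\mathbf{P}(v)\in\mathbb{P}^d$ and to each edge $e$ a line $\mathbf{P}(e)\subset\mathbb{P}^d$ containing $\mathbf{P}(v)$ for each endpoint $v$ of $e$; it is generic if the points $\mathbf{P}(v)$ are pairwise distinct. The edge set $E$ is $d$-parallel independent (independent in the generic $d$-parallel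 matroid) if $G$ has no loops and the directions of the lines representing the edges in a generic picture are mutually unconstrained. Precisely, the second condition says that the map sending a tuple $(p_v)_{v\in V}$ of pairwise distinct points of $\mathbb{C}^d$ to $([p_v-p_w])_{e=vw\in E}\in(\mathbb{P}^{d-1}_{\mathbb{C}})^E$ has Zariski-dense image, where $[p_v-p_w]$ is the direction of the line through $p_v$ and $p_w$. In particular a single loop, and a pair of parallel nonloop edges, are dependent. *)

theory Defs
  imports
    "HOL.Hull"
    "HOL-Library.FuncSet"
    "HOL-Library.Uprod"
    "HOL-Library.Poly_Mapping"
    "HOL-Computational_Algebra.Polynomial_Factorial"
    "Jordan_Normal_Form.Matrix"
begin

subsection \<open>Finite multigraphs\<close>

text \<open>Edges are abstract objects, so parallel edges are allowed; an edge \<open>e\<close> is a loop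
  iff \<open>ends e = Upair v v\<close> for some \<open>v\<close>.\<close>

record ('v, 'e) multigraph =
  verts :: "'v set"
  edges :: "'e set"
  ends :: "'e \<Rightarrow> 'v uprod"

definition finite_multigraph :: "('v, 'e) multigraph \<Rightarrow> bool" where
  "finite_multigraph G \<longleftrightarrow>
     finite (verts G) \<and> verts G \<noteq> {} \<and> finite (edges G) \<and>
     (\<forall>e\<in>edges G. set_uprod (ends G e) \<subseteq> verts G)"

definition loop :: "('v, 'e) multigraph \<Rightarrow> 'e \<Rightarrow> bool" where
  "loop G e \<longleftrightarrow> (\<exists>v. ends G e = Upair v v)"

definition adjacency :: "('v, 'e) multigraph \<Rightarrow> ('v \<times> 'v) set" where
  "adjacency G = {(v, w). \<exists>e\<in>edges G. ends G e = Upair v w}"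

definition connectedness :: "('v, 'e) multigraph \<Rightarrow> ('v \<times> 'v) set" where
  "connectedness G = (adjacency G)\<^sup>* \<inter> verts G \<times> verts G"

definition num_verts :: "('v, 'e) multigraph \<Rightarrow> nat" where
  "num_verts G = card (verts G)"

definition num_components :: "('v, 'e) multigraph \<Rightarrow> nat" where
  "num_components G = card (verts G // connectedness G)"

text \<open>A cycle visits the distinct vertices \<open>vs\<close> in cyclic order through the distinct edges
  \<open>es\<close>. Length 1 gives a loop, length 2 a pair of parallel non-loop edges.\<close>

definition cycle :: "('v, 'e) multigraph \<Rightarrow> 'v list \<Rightarrow> 'e list \<Rightarrow> bool" where
  "cycle G vs es \<longleftrightarrow>
     es \<noteq> [] \<and> length vs = length es \<and> distinct vs \<and> distinct es \<and> set es \<subseteq> edges G \<and>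
     (\<forall>i<length es. ends G (es ! i) = Upair (vs ! i) (vs ! (Suc i mod length vs)))"

definition acyclic_edges :: "('v, 'e) multigraph \<Rightarrow> 'e set \<Rightarrow> bool" where
  "acyclic_edges G F \<longleftrightarrow> \<not> (\<exists>vs es. cycle G vs es \<and> set es \<subseteq> F)"

definition graph_rank :: "('v, 'e) multigraph \<Rightarrow> 'e set \<Rightarrow> nat" where
  "graph_rank G F = Max {card A | A. A \<subseteq> F \<and> acyclic_edges G A}"


subsection \<open>The Tutte polynomial\<close>

text \<open>The value of the integer polynomial \<open>T\<^sub>G\<close> at a pair of elements of any commutative ring.
  No exponent below is truncated, since \<open>graph_rank G F\<close> is at most both
  \<open>graph_rank G (edges G)\<close> and \<open>card F\<close>.\<close>

definition tutte :: "('v, 'e) multigraph \<Rightarrow> 'a::comm_ring_1 \<Rightarrow> 'a \<Rightarrow> 'a" where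
  "tutte G x y =
     (\<Sum>F\<in>Pow (edges G).
        (x - 1) ^ (graph_rank G (edges G) - graph_rank G F) *
        (y - 1) ^ (card F - graph_rank G F))"

definition q_int :: "nat \<Rightarrow> int poly" where
  "q_int m = (\<Sum>i<m. monom 1 i)"


subsection \<open>Products of complex projective spaces and their Zariski topology\<close>

text \<open>The class of a nonzero vector \<open>x\<close> in projective space, as the set of all its
  homogeneous coordinate vectors.\<close>

definition proj_class :: "complex vec \<Rightarrow> complex vec set" where
  "proj_class x = {c \<cdot>\<^sub>v x | c. c \<noteq> 0}"

text \<open>\<open>proj_of d\<close> is the projectivisation of \<open>\<complex>\<^sup>d\<close>, i.e. projective space of dimension
  \<open>d - 1\<close>.\<close>

definition proj_of :: "nat \<Rightarrow> complex vec set set" where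
  "proj_of d = proj_class ` (carrier_vec d - {0\<^sub>v d})"

definition proj_power :: "nat \<Rightarrow> 'e set \<Rightarrow> ('e \<Rightarrow> complex vec set) set" where
  "proj_power d E = (\<Pi>\<^sub>E e\<in>E. proj_of d)"

text \<open>Multivariate polynomials with variables indexed by \<open>'i\<close>: finitely supported maps from
  monomials (finitely supported exponent functions) to coefficients.\<close>

type_synonym 'i cpoly = "('i \<Rightarrow>\<^sub>0 nat) \<Rightarrow>\<^sub>0 complex"

definition eval_cpoly :: "'i cpoly \<Rightarrow> ('i \<Rightarrow> complex) \<Rightarrow> complex" where
  "eval_cpoly f x =
     (\<Sum>\<mu>\<in>Poly_Mapping.keys f.
        Poly_Mapping.lookup f \<mu> * (\<Prod>i\<in>Poly_Mapping.keys \<mu>. x i ^ Poly_Mapping.lookup \<mu> i))"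

text \<open>Variable \<open>(e, i)\<close> is the \<open>i\<close>-th homogeneous coordinate on the factor with index \<open>e\<close>.
  The polynomial has to be homogeneous in each of the \<open>E\<close> groups of variables
  separately.\<close>

definition multihomogeneous :: "nat \<Rightarrow> 'e set \<Rightarrow> ('e \<times> nat) cpoly \<Rightarrow> bool" where
  "multihomogeneous d E f \<longleftrightarrow>
     (\<exists>m :: 'e \<Rightarrow> nat. \<forall>\<mu>\<in>Poly_Mapping.keys f.
        Poly_Mapping.keys \<mu> \<subseteq> E \<times> {..<d} \<and>
        (\<forall>e\<in>E. (\<Sum>i<d. Poly_Mapping.lookup \<mu> (e, i)) = m e))"

definition zero_locus ::
    "nat \<Rightarrow> 'e set \<Rightarrow> ('e \<times> nat) cpoly set \<Rightarrow> ('e \<Rightarrow> complex vec set) set" where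
  "zero_locus d E S =
     {L \<in> proj_power d E.
        \<forall>f\<in>S. \<forall>x. (\<forall>e\<in>E. x e \<in> L e) \<longrightarrow> eval_cpoly f (\<lambda>(e, i). x e $ i) = 0}"

definition zariski_closed :: "nat \<Rightarrow> 'e set \<Rightarrow> ('e \<Rightarrow> complex vec set) set \<Rightarrow> bool" where
  "zariski_closed d E Z \<longleftrightarrow> (\<exists>S. (\<forall>f\<in>S. multihomogeneous d E f) \<and> Z = zero_locus d E S)"

definition zariski_dense :: "nat \<Rightarrow> 'e set \<Rightarrow> ('e \<Rightarrow> complex vec set) set \<Rightarrow> bool" where
  "zariski_dense d E A \<longleftrightarrow> zariski_closed d E hull A = proj_power d E"


subsection \<open>Parallel independence\<close>

text \<open>The image of the map sending pairwise distinct points \<open>p v\<close> of \<open>\<complex>\<^sup>d\<close> to the family of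
  directions of the edges. The class of \<open>p v - p w\<close> does not change when \<open>v\<close> and \<open>w\<close> are
  exchanged, so \<open>L\<close> is determined by \<open>p\<close>. The map is meaningful only for graphs
  without loops.\<close>

definition direction_image ::
    "nat \<Rightarrow> ('v, 'e) multigraph \<Rightarrow> ('e \<Rightarrow> complex vec set) set" where
  "direction_image d G =
     {L \<in> proj_power d (edges G).
        \<exists>p. p ` verts G \<subseteq> carrier_vec d \<and> inj_on p (verts G) \<and>
            (\<forall>e\<in>edges G. \<forall>v w. ends G e = Upair v w \<longrightarrow> L e = proj_class (p v - p w))}"

definition parallel_independent :: "nat \<Rightarrow> ('v, 'e) multigraph \<Rightarrow> bool" where
  "parallel_independent d G \<longleftrightarrow>
     (\<forall>e\<in>edges G. \<not> loop G e) \<and>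
     zariski_dense d (edges G) (direction_image d G)"

end

theory Submission
  imports Defs "Jordan_Normal_Form.Char_Poly"
begin

text \<open>
  Since \<open>x - 1 = [d+1]\<^sub>q / ([d]\<^sub>q - 1)\<close> and \<open>y - 1 = [d]\<^sub>q - 1\<close>, the expression equals
  \<open>\<Sum>F. [d+1]\<^sub>q ^ (r E - r F) * ([d]\<^sub>q - 1) ^ |F|\<close>, a sum of monic polynomials. No cancellation of
  leading terms is possible, so the sum is monic of degree \<open>d * r E\<close> iff every term with
  \<open>F \<noteq> {}\<close> has smaller degree, i.e. iff \<open>(d - 1) * |F| < d * r F\<close> for all nonempty \<open>F\<close>.

  If this count holds, Rado's theorem covers every edge at least \<open>d - 1\<close> times, and a chosen edge
  \<open>e\<close> in fact \<open>d\<close> times, by \<open>d\<close> forests. Placing every edge \<open>f \<noteq> e\<close> in the coordinate direction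
  belonging to the forest that misses it gives directions for which the linear equations of a
  realisation with prescribed \<open>e\<close> are solvable; solvability persists for generic
  directions, and superposing these solutions makes all edges nondegenerate. Conversely, for a
  minimal violation \<open>F\<close> Rado's theorem for the dual matroid yields coordinate directions that
  admit only the trivial realisation of \<open>F\<close>, so that a determinant, multilinear in the
  directions, vanishes on all realisable directions but not identically.
\<close>

subsection \<open>The cycle matroid of a multigraph\<close>

text \<open>The orientation is arbitrary. It gives each difference
  \<open>p (src e) - p (tgt e)\<close> a definite sign; reversing an edge negates the direction
  vector and leaves its projective class fixed.\<close>

locale oriented_multigraph =
  fixes G :: "('v, 'e) multigraph" and src tgt :: "'e \<Rightarrow> 'v"
  assumes finite_multigraph: "finite_multigraph G"
    and ends_eq: "e \<in> edges G \<Longrightarrow> ends G e = Upair (src e) (tgt e)"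
begin

abbreviation V where "V \<equiv> verts G"
abbreviation E where "E \<equiv> edges G"

section \<open>Connectivity by a set of edges\<close>

definition conn :: "'e set \<Rightarrow> ('v \<times> 'v) set" where
  "conn F = connectedness (G\<lparr>edges := F\<rparr>)"

text \<open>Vertices minus components of the spanning subgraph with edge set \<open>F\<close>. This
  form makes single-edge changes easy to follow; it is identified with the maximum over acyclic
  subsets in \<open>graph_rank_eq\<close>.\<close>

definition rank :: "'e set \<Rightarrow> nat" where
  "rank F = card V - card (V // conn F)"

lemma finite_V [simp]: "finite V" and finite_E [simp]: "finite E"
  using finite_multigraph by (auto simp: finite_multigraph_def)

lemma src_in [simp]: "e \<in> E \<Longrightarrow> src e \<in> V" and tgt_in [simp]: "e \<in> E \<Longrightarrow> tgt e \<in> V"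
proof -
  assume e: "e \<in> E"
  then have "set_uprod (ends G e) \<subseteq> V"
    using finite_multigraph by (auto simp: finite_multigraph_def)
  then show "src e \<in> V" "tgt e \<in> V" using ends_eq[OF e] by auto
qed

lemma finite_edge_set: "F \<subseteq> E \<Longrightarrow> finite F"
  using finite_subset finite_E by blast

lemma adjacency_iff:
  assumes "F \<subseteq> E"
  shows "(u, w) \<in> adjacency (G\<lparr>edges := F\<rparr>) \<longleftrightarrow>
    (\<exists>e\<in>F. u = src e \<and> w = tgt e \<or> u = tgt e \<and> w = src e)"
proof -
  have "ends G e = Upair u w \<longleftrightarrow> u = src e \<and> w = tgt e \<or> u = tgt e \<and> w = src e" if "e \<in> F" for e
    using that assms ends_eq[of e] by auto
  then show ?thesis by (auto simp: adjacency_def)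
qed

lemma equiv_conn:
  assumes "F \<subseteq> E"
  shows "equiv V (conn F)"
proof (rule equivI)
  have "sym (adjacency (G\<lparr>edges := F\<rparr>))"
    using adjacency_iff[OF assms] by (auto simp: sym_def)
  then have "sym ((adjacency (G\<lparr>edges := F\<rparr>))\<^sup>*)" by (rule sym_rtrancl)
  then show "sym (conn F)"
    by (auto simp: conn_def connectedness_def sym_def)
  show "trans (conn F)"
    by (auto simp: conn_def connectedness_def trans_def)
  show "refl_on V (conn F)" "conn F \<subseteq> V \<times> V"
    by (auto simp: conn_def connectedness_def refl_on_def)
qed

lemma conn_refl: "F \<subseteq> E \<Longrightarrow> x \<in> V \<Longrightarrow> (x, x) \<in> conn F"
  using equiv_conn by (meson equivE refl_onD)

lemma conn_sym: "F \<subseteq> E \<Longrightarrow> (x, y) \<in> conn F \<Longrightarrow> (y, x) \<in> conn F"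
  using equiv_conn by (meson equivE symD)

lemma conn_trans: "F \<subseteq> E \<Longrightarrow> (x, y) \<in> conn F \<Longrightarrow> (y, z) \<in> conn F \<Longrightarrow> (x, z) \<in> conn F"
  using equiv_conn by (meson equivE transD)

lemma conn_in: "F \<subseteq> E \<Longrightarrow> (x, y) \<in> conn F \<Longrightarrow> x \<in> V \<and> y \<in> V"
  by (auto simp: conn_def connectedness_def)

lemma edge_in_conn:
  assumes "F \<subseteq> E" "e \<in> F"
  shows "(src e, tgt e) \<in> conn F"
  using assms adjacency_iff[OF assms(1), of "src e" "tgt e"]
  by (auto simp: conn_def connectedness_def subset_iff)

text \<open>\<open>conn F\<close> is the equivalence relation generated by the edges, so a property
  of connected pairs follows once it defines an equivalence relation containing the edges.\<close>

lemma conn_least: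
  assumes "F \<subseteq> E" and Q: "equiv V Q" and edge: "\<And>e. e \<in> F \<Longrightarrow> (src e, tgt e) \<in> Q"
  shows "conn F \<subseteq> Q"
proof
  fix z assume "z \<in> conn F"
  then obtain u w where z: "z = (u, w)" and uw: "(u, w) \<in> (adjacency (G\<lparr>edges := F\<rparr>))\<^sup>*" "u \<in> V"
    by (auto simp: conn_def connectedness_def)
  from uw have "(u, w) \<in> Q"
  proof (induction rule: rtrancl_induct)
    case base
    then show ?case using Q by (meson equivE refl_onD)
  next
    case (step y z)
    have "(y, z) \<in> Q"
      using step(2) adjacency_iff[OF assms(1)] edge Q by (metis equivE symD)
    then show ?case using step.IH step.prems Q by (meson equivE transD)
  qed
  then show "z \<in> Q" using z by simp
qed

lemma conn_mono:
  assumes "A \<subseteq> B" "B \<subseteq> E"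
  shows "conn A \<subseteq> conn B"
  using assms by (intro conn_least equiv_conn edge_in_conn) auto

lemma conn_insert_connected:
  assumes "F \<subseteq> E" "e \<in> E" "(src e, tgt e) \<in> conn F"
  shows "conn (insert e F) = conn F"
proof
  show "conn (insert e F) \<subseteq> conn F"
    using assms by (intro conn_least equiv_conn) (auto simp: edge_in_conn)
  show "conn F \<subseteq> conn (insert e F)"
    using assms by (intro conn_mono) auto
qed

text \<open>The new edge merges the classes \<open>A\<close> and \<open>B\<close> of its ends and
  leaves every other class alone, so exactly one class is lost.\<close>

lemma card_quotient_conn_insert:
  assumes F: "F \<subseteq> E" and e: "e \<in> E" and nc: "(src e, tgt e) \<notin> conn F"
  shows "card (V // conn F) = Suc (card (V // conn (insert e F)))"
proof -
  define A where "A = conn F `` {src e}"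
  define B where "B = conn F `` {tgt e}"
  define Q where "Q = conn F \<union> (A \<union> B) \<times> (A \<union> B)"
  have eq: "equiv V (conn F)" by (rule equiv_conn[OF F])
  have Fe: "insert e F \<subseteq> E" using F e by simp
  have AV: "A \<in> V // conn F" "B \<in> V // conn F"
    using e by (auto simp: A_def B_def intro!: quotientI)
  have sub: "A \<subseteq> V" "B \<subseteq> V"
    using conn_in[OF F] unfolding A_def B_def by blast+
  have closed: "y \<in> A \<union> B" if "x \<in> A \<union> B" "(x, y) \<in> conn F" for x y
    using that conn_trans[OF F] unfolding A_def B_def by blast
  have closed': "x \<in> A \<union> B" if "y \<in> A \<union> B" "(x, y) \<in> conn F" for x y
    using closed[OF that(1)] that(2) conn_sym[OF F] by blast
  have srcA: "src e \<in> A" and tgtB: "tgt e \<in> B"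
    using src_in[OF e] tgt_in[OF e] conn_refl[OF F] unfolding A_def B_def by blast+
  have eqQ: "equiv V Q"
  proof (rule equivI)
    show "refl_on V Q" using conn_refl[OF F] unfolding Q_def refl_on_def by blast
    show "Q \<subseteq> V \<times> V" using conn_in[OF F] sub unfolding Q_def by auto
    show "sym Q" using conn_sym[OF F] unfolding Q_def sym_def by blast
    show "trans Q"
    proof (rule transI)
      fix x y z assume xy: "(x, y) \<in> Q" and yz: "(y, z) \<in> Q"
      show "(x, z) \<in> Q"
      proof (cases "(x, y) \<in> conn F \<and> (y, z) \<in> conn F")
        case True
        then show ?thesis using conn_trans[OF F] unfolding Q_def by blast
      next
        case False
        then have "x \<in> A \<union> B" "z \<in> A \<union> B"
          using xy yz closed closed' unfolding Q_def by blast+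
        then show ?thesis unfolding Q_def by blast
      qed
    qed
  qed
  have conn_Q: "conn (insert e F) = Q"
  proof
    show "conn (insert e F) \<subseteq> Q"
      using edge_in_conn[OF F] srcA tgtB
      by (intro conn_least[OF Fe eqQ]) (auto simp: Q_def)
    have 1: "conn F \<subseteq> conn (insert e F)" using F e by (intro conn_mono) auto
    have 2: "(src e, tgt e) \<in> conn (insert e F)" using F e by (intro edge_in_conn) auto
    \<comment> \<open>From \<open>src e\<close>, by way of the new edge if necessary, every point of
      the merged class is reached.\<close>
    have 3: "(src e, x) \<in> conn (insert e F)" if "x \<in> A \<union> B" for x
      using that 1 2 conn_trans[OF Fe] unfolding A_def B_def by blast
    have "(x, y) \<in> conn (insert e F)" if "x \<in> A \<union> B" "y \<in> A \<union> B" for x y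
      using conn_trans[OF Fe conn_sym[OF Fe 3[OF that(1)]] 3[OF that(2)]] .
    then show "Q \<subseteq> conn (insert e F)"
      using 1 unfolding Q_def by blast
  qed
  have img: "Q `` {x} = (if x \<in> A \<union> B then A \<union> B else conn F `` {x})" if "x \<in> V" for x
    using closed unfolding Q_def by auto
  have cls: "x \<in> A \<union> B \<longleftrightarrow> conn F `` {x} = A \<or> conn F `` {x} = B" if "x \<in> V" for x
  proof
    assume "x \<in> A \<union> B"
    then have "(src e, x) \<in> conn F \<or> (tgt e, x) \<in> conn F" by (simp add: A_def B_def)
    then show "conn F `` {x} = A \<or> conn F `` {x} = B"
      using equiv_class_eq[OF eq] unfolding A_def B_def by blast
  next
    assume "conn F `` {x} = A \<or> conn F `` {x} = B"
    then show "x \<in> A \<union> B" using conn_refl[OF F that] by blast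
  qed
  have "V // Q = insert (A \<union> B) (V // conn F - {A, B})"
  proof (intro equalityI subsetI)
    fix X assume "X \<in> V // Q"
    then obtain x where x: "x \<in> V" "X = Q `` {x}" by (auto elim: quotientE)
    then show "X \<in> insert (A \<union> B) (V // conn F - {A, B})"
      using img[OF x(1)] cls[OF x(1)] by (auto intro: quotientI split: if_splits)
  next
    fix X assume "X \<in> insert (A \<union> B) (V // conn F - {A, B})"
    then consider "X = A \<union> B" | "X \<in> V // conn F" "X \<noteq> A" "X \<noteq> B" by auto
    then show "X \<in> V // Q"
    proof cases
      case 1
      then have "X = Q `` {src e}" using img[of "src e"] e srcA by auto
      then show ?thesis using e by (auto intro: quotientI)
    next
      case 2
      then obtain x where x: "x \<in> V" "X = conn F `` {x}" by (auto elim: quotientE)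
      then have "X = Q `` {x}" using img[OF x(1)] cls[OF x(1)] 2 by auto
      then show ?thesis using x by (auto intro: quotientI)
    qed
  qed
  moreover have "A \<union> B \<notin> V // conn F - {A, B}"
  proof
    assume "A \<union> B \<in> V // conn F - {A, B}"
    then have *: "A \<union> B \<in> V // conn F" "A \<union> B \<noteq> A" by auto
    then show False
      using quotient_disj[OF eq *(1) AV(1)] srcA by auto
  qed
  moreover have fin: "finite (V // conn F)"
    using eq by (auto intro: finite_quotient simp: equiv_def)
  moreover have "A \<noteq> B"
    using nc tgtB by (auto simp: A_def)
  ultimately have "card (V // Q) = Suc (card (V // conn F - {A, B}))"
    by simp
  also have "card (V // conn F - {A, B}) = card (V // conn F) - 2"
    using AV \<open>A \<noteq> B\<close> by (subst card_Diff_subset) auto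
  finally have "card (V // Q) = Suc (card (V // conn F) - 2)" .
  moreover have "card {A, B} \<le> card (V // conn F)"
    using AV fin by (intro card_mono) auto
  ultimately show ?thesis using conn_Q \<open>A \<noteq> B\<close> by simp
qed

lemma card_quotient_conn_le:
  assumes "F \<subseteq> E"
  shows "card (V // conn F) \<le> card V"
proof -
  have "V // conn F = (\<lambda>x. conn F `` {x}) ` V" by (auto simp: quotient_def)
  then show ?thesis by (simp add: card_image_le)
qed

section \<open>Rank axioms of the cycle matroid\<close>

lemma rank_insert:
  assumes "F \<subseteq> E" "e \<in> E"
  shows "rank (insert e F) = (if (src e, tgt e) \<in> conn F then rank F else Suc (rank F))"
  using assms conn_insert_connected card_quotient_conn_insert card_quotient_conn_le[of F]
  by (auto simp: rank_def)

lemma rank_empty [simp]: "rank {} = 0"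
proof -
  have "conn {} \<subseteq> Id_on V"
    by (rule conn_least) (auto simp: equiv_def refl_on_def sym_def trans_def)
  then have "conn {} = Id_on V"
    using equiv_conn[of "{}"] by (auto simp: equiv_def refl_on_def)
  then have "V // conn {} = (\<lambda>x. {x}) ` V"
    by (auto simp: quotient_def)
  then show ?thesis by (simp add: rank_def card_image)
qed

text \<open>Ends joined by \<open>A\<close> are joined by the larger \<open>B\<close>, so an edge
  never gains more rank over \<open>B\<close> than over \<open>A\<close>.\<close>

lemma rank_insert_submodular:
  assumes "A \<subseteq> B" "B \<subseteq> E" "e \<in> E"
  shows "rank (insert e B) + rank A \<le> rank (insert e A) + rank B"
  using assms conn_mono[OF assms(1,2)] rank_insert[of A e] rank_insert[of B e] by auto

lemma rank_union_submodular:
  assumes "finite C" "A \<subseteq> B" "B \<subseteq> E" "C \<subseteq> E"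
  shows "rank (B \<union> C) + rank A \<le> rank (A \<union> C) + rank B"
  using assms
proof (induction C rule: finite_induct)
  case (insert e C)
  have "rank (insert e (B \<union> C)) + rank (A \<union> C) \<le> rank (insert e (A \<union> C)) + rank (B \<union> C)"
    using insert by (intro rank_insert_submodular) auto
  then show ?case using insert by auto
qed auto

lemma rank_submodular:
  assumes "A \<subseteq> E" "B \<subseteq> E"
  shows "rank (A \<union> B) + rank (A \<inter> B) \<le> rank A + rank B"
  using rank_union_submodular[of A "A \<inter> B" B] assms finite_edge_set[of A]
  by (simp add: Un_commute Un_absorb2)

lemma rank_union_le:
  assumes "finite C" "A \<subseteq> E" "C \<subseteq> E"
  shows "rank A \<le> rank (A \<union> C) \<and> rank (A \<union> C) \<le> rank A + card C"
  using assms
proof (induction C rule: finite_induct)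
  case (insert e C)
  then show ?case using rank_insert[of "A \<union> C" e] by (auto split: if_splits)
qed auto

lemma rank_mono:
  assumes "A \<subseteq> B" "B \<subseteq> E"
  shows "rank A \<le> rank B"
  using rank_union_le[of B A] assms finite_edge_set[of B] by (simp add: Un_absorb1)

lemma rank_le_card: "F \<subseteq> E \<Longrightarrow> rank F \<le> card F"
  using rank_union_le[of F "{}"] finite_edge_set[of F] by simp

lemma rank_E: "rank E = num_verts G - num_components G"
proof -
  have "G\<lparr>edges := edges G\<rparr> = G" by simp
  then show ?thesis by (simp add: rank_def num_verts_def num_components_def conn_def)
qed

section \<open>Spanning sets, independent sets and bases\<close>

lemma connected_if_rank_eq:
  assumes "A \<subseteq> F" "F \<subseteq> E" "rank F \<le> rank A" "e \<in> F"
  shows "(src e, tgt e) \<in> conn A"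
proof (rule ccontr)
  assume "\<not> ?thesis"
  then have "rank (insert e A) = Suc (rank A)" using assms rank_insert[of A e] by auto
  moreover have "rank (insert e A) \<le> rank F" using assms by (intro rank_mono) auto
  ultimately show False using assms by simp
qed

text \<open>Otherwise deleting \<open>e\<close> would keep the rank, which would then be less than
  \<open>card F\<close>.\<close>

lemma disconnected_if_independent:
  assumes "F \<subseteq> E" "card F \<le> rank F" "e \<in> F"
  shows "(src e, tgt e) \<notin> conn (F - {e})"
proof
  assume "(src e, tgt e) \<in> conn (F - {e})"
  then have "rank F = rank (F - {e})"
    using rank_insert[of "F - {e}" e] assms by (auto simp: insert_absorb)
  also have "\<dots> \<le> card (F - {e})" using assms by (intro rank_le_card) auto
  also have "\<dots> < card F" using assms finite_edge_set by (intro psubset_card_mono) auto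
  finally show False using assms by simp
qed

lemma independent_if_disconnected:
  assumes "F \<subseteq> E" "\<And>e. e \<in> F \<Longrightarrow> (src e, tgt e) \<notin> conn (F - {e})"
  shows "rank F = card F"
  using finite_edge_set[OF assms(1)] assms
proof (induction F rule: finite_induct)
  case (insert e F)
  have "rank F = card F"
  proof (rule insert.IH)
    fix f assume f: "f \<in> F"
    have "conn (F - {f}) \<subseteq> conn (insert e F - {f})"
      using insert.prems by (intro conn_mono) auto
    then show "(src f, tgt f) \<notin> conn (F - {f})" using insert.prems(2)[of f] f by auto
  qed (use insert.prems in auto)
  moreover have "(src e, tgt e) \<notin> conn F" using insert.prems(2)[of e] insert.hyps by auto
  ultimately show ?case using insert.prems insert.hyps rank_insert[of F e] by auto
qed auto

lemma ex_basis:
  assumes "F \<subseteq> E"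
  shows "\<exists>A\<subseteq>F. rank A = card A \<and> rank A = rank F"
  using finite_edge_set[OF assms] assms
proof (induction F rule: finite_induct)
  case (insert e F)
  then obtain A where A: "A \<subseteq> F" "rank A = card A" "rank A = rank F" by auto
  show ?case
  proof (cases "(src e, tgt e) \<in> conn F")
    case True
    then show ?thesis using A insert rank_insert[of F e] by auto
  next
    case False
    then have "(src e, tgt e) \<notin> conn A" using conn_mono[of A F] A insert.prems by auto
    moreover have "e \<notin> A" "finite A" using A insert finite_subset by auto
    ultimately have "rank (insert e A) = card (insert e A)" "rank (insert e A) = rank (insert e F)"
      using A insert.prems False rank_insert[of F e] rank_insert[of A e] by auto
    then show ?thesis using A by (intro exI[of _ "insert e A"]) auto
  qed
qed auto

section \<open>Paths, cycles, and acyclic sets as independent sets\<close>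

inductive path :: "'e set \<Rightarrow> 'v \<Rightarrow> 'v list \<Rightarrow> 'e list \<Rightarrow> 'v \<Rightarrow> bool" for F where
  path_Nil: "path F u [u] [] u"
| path_Cons: "e \<in> F \<Longrightarrow> ends G e = Upair u u' \<Longrightarrow> path F u' vs es w \<Longrightarrow> u \<notin> set vs \<Longrightarrow>
    path F u (u # vs) (e # es) w"

lemma path_suffix:
  assumes "path F u vs es w" "x \<in> set vs"
  shows "\<exists>vs' es'. path F x vs' es' w"
  using assms
proof induction
  case (path_Nil u)
  then show ?case by (auto intro: path.path_Nil)
next
  case (path_Cons e u u' vs es w)
  then show ?case by (auto intro: path.path_Cons)
qed

text \<open>A walk is built up from its end. When the new vertex \<open>u\<close> already lies on
  the path, the suffix starting at \<open>u\<close> replaces it, so the path stays simple.\<close>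

lemma ex_path:
  assumes "(u, w) \<in> (adjacency (G\<lparr>edges := F\<rparr>))\<^sup>*"
  shows "\<exists>vs es. path F u vs es w"
  using assms
proof (induction rule: converse_rtrancl_induct)
  case base
  then show ?case by (auto intro: path.path_Nil)
next
  case (step u u')
  then obtain vs es where p: "path F u' vs es w" by auto
  obtain e where e: "e \<in> F" "ends G e = Upair u u'" using step(1) by (auto simp: adjacency_def)
  show ?case
  proof (cases "u \<in> set vs")
    case True
    then show ?thesis using path_suffix[OF p] by blast
  next
    case False
    then show ?thesis using path.path_Cons[OF e p] by blast
  qed
qed

lemma path_props:
  assumes "path F u vs es w"
  shows "distinct vs \<and> length vs = Suc (length es) \<and> set es \<subseteq> F \<and> vs ! 0 = u \<and>
    vs ! length es = w \<and> distinct es \<and>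
    (\<forall>i<length es. ends G (es ! i) = Upair (vs ! i) (vs ! Suc i))"
  using assms
proof induction
  case (path_Cons e u u' vs es w)
  \<comment> \<open>A repeated edge would put \<open>u\<close> on the remaining path, so distinct
    vertices force distinct edges.\<close>
  have "e \<notin> set es"
  proof
    assume "e \<in> set es"
    then obtain i where i: "i < length es" "es ! i = e" by (auto simp: in_set_conv_nth)
    then have "Upair u u' = Upair (vs ! i) (vs ! Suc i)" using path_Cons by auto
    moreover have "vs ! i \<in> set vs" "vs ! Suc i \<in> set vs" using i path_Cons by auto
    ultimately show False using path_Cons.hyps(4) by auto
  qed
  then show ?case using path_Cons by (auto simp: nth_Cons split: nat.split)
qed auto

text \<open>A cycle through \<open>e\<close> is a path between the ends of \<open>e\<close> that
  avoids \<open>e\<close>. Both sides thus say that no edge of \<open>F\<close> has its ends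
  connected by the rest of \<open>F\<close>.\<close>

lemma acyclic_edges_iff:
  assumes F: "F \<subseteq> E"
  shows "acyclic_edges G F \<longleftrightarrow> rank F = card F"
proof
  assume ac: "acyclic_edges G F"
  show "rank F = card F"
  proof (rule independent_if_disconnected[OF F], rule notI)
    fix e assume e: "e \<in> F" and "(src e, tgt e) \<in> conn (F - {e})"
    then have "(src e, tgt e) \<in> (adjacency (G\<lparr>edges := F - {e}\<rparr>))\<^sup>*"
      by (simp add: conn_def connectedness_def)
    from ex_path[OF this] obtain vs es where p: "path (F - {e}) (src e) vs es (tgt e)" by blast
    note pp = path_props[OF p]
    have "ends G ((es @ [e]) ! i) = Upair (vs ! i) (vs ! (Suc i mod length vs))"
      if "i < length (es @ [e])" for i
    proof (cases "i < length es")
      case True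
      then show ?thesis using pp by (simp add: nth_append)
    next
      case False
      then have "i = length es" using that by simp
      then show ?thesis using pp ends_eq[of e] e F by (auto simp: nth_append)
    qed
    \<comment> \<open>Closing the path with \<open>e\<close> gives the cycle; for a loop the path
      has no edges.\<close>
    then have "cycle G vs (es @ [e])"
      using pp e F by (auto simp: cycle_def)
    moreover have "set (es @ [e]) \<subseteq> F" using pp e by auto
    ultimately show False using ac unfolding acyclic_edges_def by blast
  qed
next
  assume r: "rank F = card F"
  show "acyclic_edges G F"
    unfolding acyclic_edges_def
  proof (rule notI, elim exE conjE)
    fix vs es assume c: "cycle G vs es" and sub: "set es \<subseteq> F"
    \<comment> \<open>\<open>n\<close> indexes the last edge; without it the cycle is a path from
      \<open>vs ! 0\<close> to \<open>vs ! n\<close>.\<close>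
    define n where "n = length es - 1"
    have len: "length es = Suc n" "length vs = Suc n" and dist: "distinct es"
      using c by (auto simp: cycle_def n_def)
    have ends: "ends G (es ! i) = Upair (vs ! i) (vs ! (Suc i mod Suc n))" if "i \<le> n" for i
      using c that len by (auto simp: cycle_def)
    define e where "e = es ! n"
    have esF: "es ! i \<in> F" if "i \<le> n" for i using sub len that by (auto simp: subset_iff)
    have e: "e \<in> F" by (simp add: e_def esF)
    have Fe: "F - {e} \<subseteq> E" using F by auto
    have conn_step: "(vs ! i, vs ! Suc i) \<in> conn (F - {e})" if "i < n" for i
    proof -
      have "es ! i \<in> F - {e}"
        using that len dist esF[of i] by (auto simp: e_def nth_eq_iff_index_eq)
      then have "(src (es ! i), tgt (es ! i)) \<in> conn (F - {e})" using F by (intro edge_in_conn) auto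
      moreover have "Upair (src (es ! i)) (tgt (es ! i)) = Upair (vs ! i) (vs ! Suc i)"
        using ends[of i] that ends_eq[of "es ! i"] esF[of i] F by auto
      ultimately show ?thesis using conn_sym[OF Fe] by auto
    qed
    have end_eq: "Upair (src e) (tgt e) = Upair (vs ! n) (vs ! 0)"
      using ends[of n] ends_eq[of e] e F by (auto simp: e_def)
    moreover have "src e \<in> V" "tgt e \<in> V" using e F by auto
    ultimately have v0: "vs ! 0 \<in> V" by auto
    have "i \<le> n \<Longrightarrow> (vs ! 0, vs ! i) \<in> conn (F - {e})" for i
    proof (induction i)
      case 0
      then show ?case using conn_refl[OF Fe v0] by simp
    next
      case (Suc i)
      then show ?case using conn_step[of i] conn_trans[OF Fe] by (meson Suc_leD Suc_le_lessD)
    qed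
    then have "(src e, tgt e) \<in> conn (F - {e})"
      using end_eq conn_sym[OF Fe] by auto
    then show False using disconnected_if_independent[OF F] r e by simp
  qed
qed

lemma graph_rank_eq:
  assumes F: "F \<subseteq> E"
  shows "graph_rank G F = rank F"
  unfolding graph_rank_def
proof (rule Max_eqI)
  have "{card A | A. A \<subseteq> F \<and> acyclic_edges G A} \<subseteq> card ` Pow F" by auto
  then show "finite {card A | A. A \<subseteq> F \<and> acyclic_edges G A}"
    using finite_edge_set[OF F] finite_subset by blast
next
  fix y assume "y \<in> {card A | A. A \<subseteq> F \<and> acyclic_edges G A}"
  then obtain A where A: "A \<subseteq> F" "acyclic_edges G A" "y = card A" by auto
  then show "y \<le> rank F" using acyclic_edges_iff[of A] rank_mono[of A F] F by auto
next
  obtain A where "A \<subseteq> F" "rank A = card A" "rank A = rank F" using ex_basis[OF F] by auto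
  then show "rank F \<in> {card A | A. A \<subseteq> F \<and> acyclic_edges G A}"
    using acyclic_edges_iff[of A] F by force
qed

text \<open>Differences telescope along a path. The coefficients are chosen before \<open>p\<close>,
  so the same ones serve every coordinate of every realisation. The pairs admitting coefficients
  form an equivalence relation that contains the edges.\<close>

lemma potential_difference_in_span:
  assumes F: "F \<subseteq> E" and uw: "(u, w) \<in> conn F"
  shows "\<exists>c :: 'e \<Rightarrow> complex. \<forall>p :: 'v \<Rightarrow> complex.
    p u - p w = (\<Sum>f\<in>F. c f * (p (src f) - p (tgt f)))"
proof -
  define Q where "Q = {(u, w) \<in> V \<times> V. \<exists>c :: 'e \<Rightarrow> complex. \<forall>p :: 'v \<Rightarrow> complex.
    p u - p w = (\<Sum>f\<in>F. c f * (p (src f) - p (tgt f)))}"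
  have "conn F \<subseteq> Q"
  proof (rule conn_least[OF F])
    show "equiv V Q"
    proof (rule equivI)
      show "refl_on V Q" "Q \<subseteq> V \<times> V"
        by (auto simp: Q_def refl_on_def intro!: exI[of _ "\<lambda>_. 0"])
      show "sym Q"
      proof (rule symI)
        fix x y assume "(x, y) \<in> Q"
        then obtain c :: "'e \<Rightarrow> complex" where xy: "x \<in> V" "y \<in> V" and
          c: "\<And>p. p x - p y = (\<Sum>f\<in>F. c f * (p (src f) - p (tgt f)))"
          by (auto simp: Q_def)
        have "p y - p x = (\<Sum>f\<in>F. - c f * (p (src f) - p (tgt f)))" for p :: "'v \<Rightarrow> complex"
        proof -
          have "p y - p x = - (p x - p y)" by simp
          also have "\<dots> = (\<Sum>f\<in>F. - c f * (p (src f) - p (tgt f)))"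
            unfolding c[of p] sum_negf[symmetric] by (intro sum.cong) simp_all
          finally show ?thesis .
        qed
        then show "(y, x) \<in> Q" using xy by (auto simp: Q_def intro!: exI[of _ "\<lambda>f. - c f"])
      qed
      show "trans Q"
      proof (rule transI)
        fix x y z assume "(x, y) \<in> Q" "(y, z) \<in> Q"
        then obtain c c' :: "'e \<Rightarrow> complex" where xy: "x \<in> V" "z \<in> V" and
          c: "\<And>p. p x - p y = (\<Sum>f\<in>F. c f * (p (src f) - p (tgt f)))" and
          c': "\<And>p. p y - p z = (\<Sum>f\<in>F. c' f * (p (src f) - p (tgt f)))"
          by (auto simp: Q_def)
        have "p x - p z = (\<Sum>f\<in>F. (c f + c' f) * (p (src f) - p (tgt f)))" for p :: "'v \<Rightarrow> complex"
        proof -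
          have "p x - p z = (p x - p y) + (p y - p z)" by simp
          then show ?thesis unfolding c[of p] c'[of p] by (simp add: distrib_right sum.distrib)
        qed
        then show "(x, z) \<in> Q" using xy by (auto simp: Q_def intro!: exI[of _ "\<lambda>f. c f + c' f"])
      qed
    qed
    fix e assume e: "e \<in> F"
    have "p (src e) - p (tgt e) =
      (\<Sum>f\<in>F. (if f = e then 1 else 0) * (p (src f) - p (tgt f)))" for p :: "'v \<Rightarrow> complex"
      using e finite_edge_set[OF F] by (simp add: if_distrib[of "\<lambda>x. x * _"] cong: if_cong)
    then show "(src e, tgt e) \<in> Q"
      using e F by (auto simp: Q_def intro!: exI[of _ "\<lambda>f. if f = e then 1 else 0"])
  qed
  then show ?thesis using uw by (auto simp: Q_def)
qed

text \<open>Removing \<open>e\<close> from an independent set separates its ends. The indicator of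
  the component of \<open>src e\<close> drops by 1 across \<open>e\<close> and is constant along
  every other edge.\<close>

lemma ex_separating_potential:
  assumes F: "F \<subseteq> E" and indep: "card F \<le> rank F" and e: "e \<in> F"
  shows "\<exists>p :: 'v \<Rightarrow> complex. \<forall>f\<in>F. p (src f) - p (tgt f) = (if f = e then 1 else 0)"
proof -
  let ?R = "conn (F - {e})"
  have Fe: "F - {e} \<subseteq> E" using F by auto
  define p :: "'v \<Rightarrow> complex" where "p v = (if (src e, v) \<in> ?R then 1 else 0)" for v
  have "p (src f) - p (tgt f) = (if f = e then 1 else 0)" if f: "f \<in> F" for f
  proof (cases "f = e")
    case True
    then show ?thesis
      using disconnected_if_independent[OF F indep e] conn_refl[OF Fe] F e
      by (auto simp: p_def)
  next
    case False
    then have "(src f, tgt f) \<in> ?R" using F f by (intro edge_in_conn) auto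
    then have "(src e, src f) \<in> ?R \<longleftrightarrow> (src e, tgt f) \<in> ?R"
      using conn_sym[OF Fe] conn_trans[OF Fe] by blast
    then show ?thesis using False by (simp add: p_def)
  qed
  then show ?thesis by blast
qed

end

subsection \<open>Transversals of submodular functions\<close>

text \<open>The sets are shrunk until all are singletons; then Hall's condition for \<open>I\<close>
  is the claim. For a matroid rank function \<open>f\<close> the bound on \<open>f\<close> says that
  the transversal is injective and independent.\<close>

lemma rado_transversal:
  fixes f :: "'a set \<Rightarrow> nat" and S :: "'i \<Rightarrow> 'a set"
  assumes "finite I" "finite U"
    and empty: "f {} = 0"
    and mono: "\<And>A B. A \<subseteq> B \<Longrightarrow> B \<subseteq> U \<Longrightarrow> f A \<le> f B"
    and submodular: "\<And>A B. A \<subseteq> U \<Longrightarrow> B \<subseteq> U \<Longrightarrow> f (A \<union> B) + f (A \<inter> B) \<le> f A + f B"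
    and "\<And>i. i \<in> I \<Longrightarrow> S i \<subseteq> U"
    and "\<And>J. J \<subseteq> I \<Longrightarrow> card J \<le> f (\<Union>i\<in>J. S i)"
  shows "\<exists>s. (\<forall>i\<in>I. s i \<in> S i) \<and> card I \<le> f (s ` I)"
  using assms(6,7)
proof (induction "\<Sum>i\<in>I. card (S i)" arbitrary: S rule: less_induct)
  case less
  note SU = less.prems(1) and hall = less.prems(2)
  have fin: "finite (S i)" if "i \<in> I" for i
    using SU[OF that] \<open>finite U\<close> finite_subset by blast
  show ?case
  proof (cases "\<exists>i\<in>I. \<exists>a\<in>S i. \<exists>b\<in>S i. a \<noteq> b")
    case False
    have nonempty: "S i \<noteq> {}" if "i \<in> I" for i
      using hall[of "{i}"] that empty by auto
    define s where "s i = (SOME a. a \<in> S i)" for i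
    have s: "s i \<in> S i" if "i \<in> I" for i
      unfolding s_def using nonempty[OF that] by (simp add: some_in_eq)
    have "S i = {s i}" if "i \<in> I" for i
      using s[OF that] False that by blast
    then have "(\<Union>i\<in>I. S i) = s ` I" by auto
    then show ?thesis using hall[of I] s by auto
  next
    case True
    then obtain i a b where i: "i \<in> I" and ab: "a \<in> S i" "b \<in> S i" "a \<noteq> b" by blast
    \<comment> \<open>Shrink \<open>S i\<close> while keeping Hall's condition: if both \<open>a\<close> and \<open>b\<close> were indispensable,
      uncrossing the two violated conditions would contradict submodularity.\<close>
    define S' where "S' c = S(i := S i - {c})" for c
    have shrink: ?thesis
      if c: "c \<in> S i" and hall': "\<And>J. J \<subseteq> I - {i} \<Longrightarrow> Suc (card J) \<le> f ((\<Union>j\<in>J. S j) \<union> (S i - {c}))" for c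
    proof -
      have "\<exists>s. (\<forall>j\<in>I. s j \<in> S' c j) \<and> card I \<le> f (s ` I)"
      proof (rule less.hyps)
        have "card (S i - {c}) < card (S i)" using fin[OF i] c by (intro psubset_card_mono) auto
        then show "(\<Sum>j\<in>I. card (S' c j)) < (\<Sum>j\<in>I. card (S j))"
          using i \<open>finite I\<close> by (intro sum_strict_mono_ex1) (auto simp: S'_def intro!: bexI[of _ i])
        show "S' c j \<subseteq> U" if "j \<in> I" for j
          using SU[OF that] by (auto simp: S'_def)
        \<comment> \<open>Hall's condition changes only for index sets containing \<open>i\<close>;
          the added 1 in \<open>hall'\<close> counts \<open>i\<close> itself.\<close>
        show "card J \<le> f (\<Union>j\<in>J. S' c j)" if J: "J \<subseteq> I" for J
        proof (cases "i \<in> J")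
          case True
          then have "(\<Union>j\<in>J. S' c j) = (\<Union>j\<in>J - {i}. S j) \<union> (S i - {c})"
            by (auto simp: S'_def split: if_splits)
          moreover have "card J = Suc (card (J - {i}))"
            using True J \<open>finite I\<close> finite_subset by (metis card_Suc_Diff1)
          ultimately show ?thesis using hall'[of "J - {i}"] J by auto
        next
          case False
          then have "(\<Union>j\<in>J. S' c j) = (\<Union>j\<in>J. S j)" by (auto simp: S'_def)
          then show ?thesis using hall[OF J] by simp
        qed
      qed
      moreover have "S' c j \<subseteq> S j" for j by (auto simp: S'_def)
      ultimately show ?thesis by blast
    qed
    show ?thesis
    proof (rule ccontr)
      assume contr: "\<not> ?thesis"
      obtain A where A: "A \<subseteq> I - {i}" "f ((\<Union>j\<in>A. S j) \<union> (S i - {a})) \<le> card A"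
        using shrink[OF ab(1)] contr by (meson not_less_eq_eq)
      obtain B where B: "B \<subseteq> I - {i}" "f ((\<Union>j\<in>B. S j) \<union> (S i - {b})) \<le> card B"
        using shrink[OF ab(2)] contr by (meson not_less_eq_eq)
      let ?X = "(\<Union>j\<in>A. S j) \<union> (S i - {a})" and ?Y = "(\<Union>j\<in>B. S j) \<union> (S i - {b})"
      have XU: "?X \<subseteq> U" "?Y \<subseteq> U" using SU A B i by blast+
      have finAB: "finite A" "finite B" using A B \<open>finite I\<close> finite_subset by blast+
      \<comment> \<open>\<open>b\<close> survives in the first shrunken set and \<open>a\<close> in
        the second, so together they restore all of \<open>S i\<close>.\<close>
      have "?X \<union> ?Y = (\<Union>j\<in>insert i (A \<union> B). S j)" using ab by auto
      then have "card (insert i (A \<union> B)) \<le> f (?X \<union> ?Y)"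
        using hall[of "insert i (A \<union> B)"] A(1) B(1) i by (metis Un_subset_iff insert_subset subset_trans Diff_subset)
      then have 1: "Suc (card (A \<union> B)) \<le> f (?X \<union> ?Y)"
        using A B finAB by (subst (asm) card_insert_disjoint) auto
      have "card (A \<inter> B) \<le> f (\<Union>j\<in>A \<inter> B. S j)" using A by (intro hall) auto
      also have "\<dots> \<le> f (?X \<inter> ?Y)" using XU by (intro mono) auto
      finally have 2: "card (A \<inter> B) \<le> f (?X \<inter> ?Y)" .
      show False
        using submodular[OF XU] 1 2 A(2) B(2) card_Un_Int[OF finAB] by linarith
    qed
  qed
qed

subsection \<open>Generic points and polynomials\<close>

text \<open>Plays the role of the Zariski open sets: finite intersections of nonempty sets of this kind are
  again nonempty, and no dimension count or irreducibility argument is needed.\<close>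

definition line_open :: "('i \<Rightarrow> complex) set \<Rightarrow> bool" where
  "line_open U \<longleftrightarrow> (\<forall>x\<in>U. \<forall>y. finite {s. (\<lambda>i. x i + s * y i) \<notin> U})"

lemma ex_avoiding_finite:
  assumes "finite (A :: complex set)"
  shows "\<exists>s. s \<notin> A"
  using assms infinite_UNIV_char_0 ex_new_if_finite by blast

lemma line_open_Int:
  assumes "line_open U" "line_open W"
  shows "line_open (U \<inter> W)"
  unfolding line_open_def
proof (intro ballI allI)
  fix x y assume "x \<in> U \<inter> W"
  then have "finite ({s. (\<lambda>i. x i + s * y i) \<notin> U} \<union> {s. (\<lambda>i. x i + s * y i) \<notin> W})"
    using assms by (auto simp: line_open_def)
  then show "finite {s. (\<lambda>i. x i + s * y i) \<notin> U \<inter> W}"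
    by (rule rev_finite_subset) auto
qed

text \<open>On the line through a point of each set, either set misses only finitely many
  parameters, and the complex numbers are infinite. The definition bases a line at a point of the
  set, so for \<open>W\<close> the line is run backwards, by \<open>1 - s\<close>.\<close>

lemma line_open_Int_nonempty:
  assumes "line_open U" "line_open W" "U \<noteq> {}" "W \<noteq> {}"
  shows "U \<inter> W \<noteq> {}"
proof -
  obtain u w where uw: "u \<in> U" "w \<in> W" using assms by auto
  have 1: "finite {s. (\<lambda>i. u i + s * (w i - u i)) \<notin> U}"
    using assms uw by (auto simp: line_open_def)
  have "finite {s. (\<lambda>i. w i + s * (u i - w i)) \<notin> W}"
    using assms uw by (auto simp: line_open_def)
  moreover have "{s. (\<lambda>i. u i + s * (w i - u i)) \<notin> W} \<subseteq>
      (\<lambda>s. 1 - s) ` {s. (\<lambda>i. w i + s * (u i - w i)) \<notin> W}"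
  proof
    fix s assume "s \<in> {s. (\<lambda>i. u i + s * (w i - u i)) \<notin> W}"
    moreover have "u i + s * (w i - u i) = w i + (1 - s) * (u i - w i)" for i
      by (simp add: algebra_simps)
    ultimately show "s \<in> (\<lambda>s. 1 - s) ` {s. (\<lambda>i. w i + s * (u i - w i)) \<notin> W}"
      by (intro image_eqI[of _ _ "1 - s"]) auto
  qed
  ultimately have "finite {s. (\<lambda>i. u i + s * (w i - u i)) \<notin> W}"
    using finite_surj by blast
  with 1 obtain s where
    "s \<notin> {s. (\<lambda>i. u i + s * (w i - u i)) \<notin> U} \<union> {s. (\<lambda>i. u i + s * (w i - u i)) \<notin> W}"
    using ex_avoiding_finite by blast
  then show ?thesis by auto
qed

lemma line_open_INT:
  assumes "finite I" "\<And>k. k \<in> I \<Longrightarrow> line_open (U k)" "\<And>k. k \<in> I \<Longrightarrow> U k \<noteq> {}"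
  shows "line_open (\<Inter>k\<in>I. U k) \<and> (\<Inter>k\<in>I. U k) \<noteq> {}"
  using assms
proof (induction I rule: finite_induct)
  case empty
  then show ?case by (auto simp: line_open_def)
next
  case (insert k I)
  then show ?case
    using line_open_Int[of "U k" "\<Inter>k\<in>I. U k"] line_open_Int_nonempty[of "U k" "\<Inter>k\<in>I. U k"]
    by auto
qed

section \<open>Restriction to lines and the identity principle\<close>

lemma finite_affine_zeros:
  assumes "(a :: complex) \<noteq> 0"
  shows "finite {s. a + s * b = 0}"
proof (rule finite_subset)
  show "{s. a + s * b = 0} \<subseteq> {- a / b}"
  proof
    fix s assume "s \<in> {s. a + s * b = 0}"
    then have "s * b = - a" by (simp add: eq_neg_iff_add_eq_0 add.commute)
    moreover from this have "b \<noteq> 0" using assms by auto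
    ultimately show "s \<in> {- a / b}" by (simp add: field_simps)
  qed
qed simp

lemma line_open_linear_nonzero:
  assumes lin: "\<And>x y s. T (\<lambda>i. x i + s * y i) = T x + s * (T y :: complex)"
  shows "line_open {x. T x \<noteq> 0}"
  using finite_affine_zeros by (auto simp: line_open_def lin)

lemma eval_cpoly_on_line:
  "\<exists>Q. \<forall>s. eval_cpoly f (\<lambda>i. x i + s * y i) = poly Q s"
proof
  show "\<forall>s. eval_cpoly f (\<lambda>i. x i + s * y i) = poly (\<Sum>\<mu>\<in>Poly_Mapping.keys f.
    [:Poly_Mapping.lookup f \<mu>:] *
    (\<Prod>i\<in>Poly_Mapping.keys \<mu>. [:x i, y i:] ^ Poly_Mapping.lookup \<mu> i)) s"
    by (simp add: eval_cpoly_def poly_sum poly_prod)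
qed

text \<open>On the line from a point \<open>u\<close> of \<open>U\<close> to \<open>x\<close> the
  polynomial becomes univariate and vanishes at all but finitely many parameters, hence identically;
  \<open>s = 1\<close> gives \<open>x\<close>. The linear map \<open>T\<close> lets the open
  condition be imposed on point positions instead of on the variables of \<open>f\<close>.\<close>

lemma eval_cpoly_zero_if_zero_on_line_open:
  assumes lin: "\<And>x y s. T (\<lambda>i. x i + s * y i) = (\<lambda>i. T x i + s * T y i)"
    and U: "line_open U" "U \<noteq> {}"
    and zero: "\<And>u. u \<in> U \<Longrightarrow> eval_cpoly f (T u) = 0"
  shows "eval_cpoly f (T x) = 0"
proof -
  obtain u where u: "u \<in> U" using U by auto
  let ?y = "\<lambda>i. x i - u i"
  obtain Q where Q: "\<And>s. eval_cpoly f (\<lambda>i. T u i + s * T ?y i) = poly Q s"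
    using eval_cpoly_on_line by blast
  have "finite {s. (\<lambda>i. u i + s * ?y i) \<notin> U}"
    using U u by (auto simp: line_open_def)
  moreover have "{s. poly Q s \<noteq> 0} \<subseteq> {s. (\<lambda>i. u i + s * ?y i) \<notin> U}"
    using zero by (auto simp: Q[symmetric] lin[symmetric])
  ultimately have "finite {s. poly Q s \<noteq> 0}"
    using finite_subset by blast
  moreover have "{s. poly Q s \<noteq> 0} \<union> {s. poly Q s = 0} = UNIV" by auto
  ultimately have "infinite {s. poly Q s = 0}"
    using infinite_UNIV_char_0[where 'a = complex] finite_UnI[of "{s. poly Q s \<noteq> 0}" "{s. poly Q s = 0}"]
    by auto
  then have "Q = 0" using poly_roots_finite by blast
  then have "eval_cpoly f (\<lambda>i. T u i + 1 * T ?y i) = 0" by (simp only: Q) simp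
  also have "(\<lambda>i. T u i + 1 * T ?y i) = T x" by (simp only: lin[symmetric]) simp
  finally show ?thesis .
qed

section \<open>Perturbations of the identity matrix\<close>

lemma sum_enumerate:
  assumes "bij_betw g {0..<n} I"
  shows "(\<Sum>i\<in>I. h i) = (\<Sum>k = 0..<n. h (g k))"
  by (rule sum.reindex_bij_betw[OF assms, symmetric])

text \<open>The system is \<open>(1 + s C) t = c\<close>. For \<open>s \<noteq> 0\<close>, a
  singular \<open>1 + s C\<close> makes \<open>- 1 / s\<close> an eigenvalue of \<open>C\<close>,
  and the characteristic polynomial has finitely many roots.\<close>

lemma finite_singular_perturbations:
  fixes C :: "'i \<Rightarrow> 'i \<Rightarrow> complex"
  assumes "finite I"
  shows "finite {s. \<not> (\<forall>c. \<exists>t. \<forall>i\<in>I. t i + s * (\<Sum>j\<in>I. C i j * t j) = c i)}"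
proof -
  obtain g where g: "bij_betw g {0..<card I} I"
    using ex_bij_betw_nat_finite[OF assms] by blast
  define n where "n = card I"
  define g' where "g' = the_inv_into {0..<n} g"
  have gI: "g k \<in> I" if "k < n" for k using g that by (auto simp: bij_betw_def n_def)
  have g'g: "g' (g k) = k" if "k < n" for k
    using g that by (auto simp: g'_def n_def bij_betw_def the_inv_into_f_f)
  have ex_g: "\<exists>k<n. i = g k" if "i \<in> I" for i
    using bij_betw_imp_surj_on[OF g] that by (fastforce simp: n_def)
  define A where "A = mat n n (\<lambda>(r, c). C (g r) (g c))"
  have A: "A \<in> carrier_mat n n" by (simp add: A_def)
  define R where "R = {k. poly (char_poly A) k = 0}"
  have "char_poly A \<noteq> 0" using degree_monic_char_poly[OF A] by auto
  then have R: "finite R" unfolding R_def by (rule poly_roots_finite)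
  have "\<forall>c. \<exists>t. \<forall>i\<in>I. t i + s * (\<Sum>j\<in>I. C i j * t j) = c i" if s: "s \<notin> insert 0 ((\<lambda>k. - 1 / k) ` R)" for s
  proof
    fix c
    let ?M = "1\<^sub>m n + s \<cdot>\<^sub>m A"
    have M: "?M \<in> carrier_mat n n" using A by simp
    have M_index: "(?M *\<^sub>v v) $ k = v $ k + s * (A *\<^sub>v v) $ k" if "v \<in> carrier_vec n" "k < n" for v k
    proof -
      have "(?M *\<^sub>v v) $ k = (\<Sum>j = 0..<n. (if k = j then v $ j else 0) + s * (A $$ (k, j) * v $ j))"
        using A that by (auto simp: scalar_prod_def algebra_simps intro!: sum.cong)
      also have "\<dots> = v $ k + s * (A *\<^sub>v v) $ k"
        using A that by (simp add: scalar_prod_def sum.distrib sum_distrib_left)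
      finally show ?thesis .
    qed
    have "det ?M \<noteq> 0"
    proof
      assume "det ?M = 0"
      then obtain v where v: "v \<in> carrier_vec n" "v \<noteq> 0\<^sub>v n" "?M *\<^sub>v v = 0\<^sub>v n"
        using det_0_iff_vec_prod_zero_field[OF M] by blast
      have Av: "A *\<^sub>v v \<in> carrier_vec n" using A v by simp
      have "v $ k + s * (A *\<^sub>v v) $ k = 0" if "k < n" for k
        using M_index[OF v(1) that] v(3) that by simp
      then have "(A *\<^sub>v v) $ k = (- 1 / s) * v $ k" if "k < n" for k
        using that s by (auto simp: field_simps eq_neg_iff_add_eq_0)
      then have "A *\<^sub>v v = (- 1 / s) \<cdot>\<^sub>v v" using v Av A by (intro eq_vecI) auto
      then have "eigenvalue A (- 1 / s)"
        using v A unfolding eigenvalue_def eigenvector_def by auto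
      then have "- 1 / s \<in> R" using eigenvalue_root_char_poly[OF A] by (simp add: R_def)
      then have "s \<in> (\<lambda>k. - 1 / k) ` R" by (intro image_eqI[of _ _ "- 1 / s"]) auto
      then show False using s by simp
    qed
    from det_non_zero_imp_unit[OF M this, of "()"] obtain B where
      B: "B \<in> carrier_mat n n" "?M * B = 1\<^sub>m n"
      by (auto simp: Units_def ring_mat_def)
    define v where "v = B *\<^sub>v vec n (\<lambda>k. c (g k))"
    have v: "v \<in> carrier_vec n" using B by (simp add: v_def)
    have "?M *\<^sub>v v = (?M * B) *\<^sub>v vec n (\<lambda>k. c (g k))"
      unfolding v_def using M B by (intro assoc_mult_mat_vec[symmetric]) auto
    then have Mv: "?M *\<^sub>v v = vec n (\<lambda>k. c (g k))" using B by simp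
    have "v $ k + s * (\<Sum>j = 0..<n. C (g k) (g j) * v $ j) = c (g k)" if "k < n" for k
    proof -
      have "v $ k + s * (A *\<^sub>v v) $ k = v $ k + s * (\<Sum>j = 0..<n. C (g k) (g j) * v $ j)"
        using A v that by (simp add: A_def scalar_prod_def)
      then show ?thesis using Mv M_index[OF v that] that by auto
    qed
    then have "\<forall>i\<in>I. v $ g' i + s * (\<Sum>j\<in>I. C i j * v $ g' j) = c i"
      unfolding sum_enumerate[OF g[folded n_def]] using ex_g by (fastforce simp: g'g)
    then show "\<exists>t. \<forall>i\<in>I. t i + s * (\<Sum>j\<in>I. C i j * t j) = c i"
      by (intro exI[of _ "\<lambda>i. v $ g' i"])
  qed
  then have "{s. \<not> (\<forall>c. \<exists>t. \<forall>i\<in>I. t i + s * (\<Sum>j\<in>I. C i j * t j) = c i)} \<subseteq>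
    insert 0 ((\<lambda>k. - 1 / k) ` R)" by blast
  then show ?thesis using R finite_subset by blast
qed

section \<open>Evaluation and scaling of multihomogeneous polynomials\<close>

lemma eval_cpoly_superset:
  assumes "finite K" "Poly_Mapping.keys f \<subseteq> K"
  shows "eval_cpoly f x = (\<Sum>\<mu>\<in>K. Poly_Mapping.lookup f \<mu> *
    (\<Prod>i\<in>Poly_Mapping.keys \<mu>. x i ^ Poly_Mapping.lookup \<mu> i))"
  unfolding eval_cpoly_def using assms
  by (intro sum.mono_neutral_left) (auto simp: in_keys_iff)

lemma eval_cpoly_add: "eval_cpoly (f + g) x = eval_cpoly f x + eval_cpoly g x"
proof -
  let ?K = "Poly_Mapping.keys f \<union> Poly_Mapping.keys g"
  have K: "finite ?K" by simp
  show ?thesis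
    using eval_cpoly_superset[OF K, of f x] eval_cpoly_superset[OF K, of g x]
      eval_cpoly_superset[OF K Poly_Mapping.keys_add, of x]
    by (simp add: lookup_add distrib_right sum.distrib)
qed

lemma eval_cpoly_sum: "eval_cpoly (\<Sum>h\<in>H. f h) x = (\<Sum>h\<in>H. eval_cpoly (f h) x)"
  by (induction H rule: infinite_finite_induct)
    (simp_all add: eval_cpoly_add, simp_all add: eval_cpoly_def)

lemma eval_cpoly_single:
  "eval_cpoly (Poly_Mapping.single \<mu> c) x =
    c * (\<Prod>i\<in>Poly_Mapping.keys \<mu>. x i ^ Poly_Mapping.lookup \<mu> i)"
  by (simp add: eval_cpoly_def)

lemma eval_cpoly_cong:
  assumes "multihomogeneous d E f" "\<And>e j. e \<in> E \<Longrightarrow> j < d \<Longrightarrow> x (e, j) = y (e, j)"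
  shows "eval_cpoly f x = eval_cpoly f y"
  unfolding eval_cpoly_def
proof (intro sum.cong arg_cong2[of _ _ _ _ "(*)"] prod.cong refl)
  fix \<mu> i assume "\<mu> \<in> Poly_Mapping.keys f" "i \<in> Poly_Mapping.keys \<mu>"
  then have "i \<in> E \<times> {..<d}" using assms(1) by (auto simp: multihomogeneous_def)
  then show "x i ^ Poly_Mapping.lookup \<mu> i = y i ^ Poly_Mapping.lookup \<mu> i"
    using assms(2) by auto
qed

text \<open>Every monomial has the same degree \<open>m e\<close> in the variables of
  \<open>e\<close>. Rescaling homogeneous coordinates by nonzero \<open>t e\<close> therefore does
  not affect vanishing.\<close>

lemma eval_cpoly_scale:
  assumes f: "multihomogeneous d E f" and E: "finite E"
  shows "\<exists>m. \<forall>t x. eval_cpoly f (\<lambda>(e, j). t e * x (e, j)) = (\<Prod>e\<in>E. t e ^ m e) * eval_cpoly f x"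
proof -
  obtain m where m: "\<And>\<mu>. \<mu> \<in> Poly_Mapping.keys f \<Longrightarrow> Poly_Mapping.keys \<mu> \<subseteq> E \<times> {..<d} \<and>
      (\<forall>e\<in>E. (\<Sum>i<d. Poly_Mapping.lookup \<mu> (e, i)) = m e)"
    using f by (auto simp: multihomogeneous_def)
  have "(\<Prod>i\<in>Poly_Mapping.keys \<mu>. (case i of (e, j) \<Rightarrow> t e * x (e, j)) ^ Poly_Mapping.lookup \<mu> i) =
      (\<Prod>e\<in>E. t e ^ m e) * (\<Prod>i\<in>Poly_Mapping.keys \<mu>. x i ^ Poly_Mapping.lookup \<mu> i)"
    if \<mu>: "\<mu> \<in> Poly_Mapping.keys f" for \<mu> and t :: "'a \<Rightarrow> complex" and x
  proof -
    have "(\<Prod>i\<in>Poly_Mapping.keys \<mu>. (case i of (e, j) \<Rightarrow> t e * x (e, j)) ^ Poly_Mapping.lookup \<mu> i) =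
      (\<Prod>i\<in>Poly_Mapping.keys \<mu>. t (fst i) ^ Poly_Mapping.lookup \<mu> i) *
      (\<Prod>i\<in>Poly_Mapping.keys \<mu>. x i ^ Poly_Mapping.lookup \<mu> i)"
      by (simp add: prod.distrib[symmetric] power_mult_distrib case_prod_beta)
    also have "(\<Prod>i\<in>Poly_Mapping.keys \<mu>. t (fst i) ^ Poly_Mapping.lookup \<mu> i) =
      (\<Prod>i\<in>E \<times> {..<d}. t (fst i) ^ Poly_Mapping.lookup \<mu> i)"
      using m[OF \<mu>] E by (intro prod.mono_neutral_left) (auto simp: in_keys_iff)
    also have "\<dots> = (\<Prod>e\<in>E. \<Prod>j<d. t e ^ Poly_Mapping.lookup \<mu> (e, j))"
      by (subst prod.cartesian_product) (simp add: case_prod_beta)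
    also have "\<dots> = (\<Prod>e\<in>E. t e ^ m e)"
      using m[OF \<mu>] by (intro prod.cong) (auto simp: power_sum[symmetric])
    finally show ?thesis .
  qed
  then show ?thesis
    by (intro exI[of _ m] allI)
      (auto simp: eval_cpoly_def sum_distrib_left mult.left_commute intro!: sum.cong)
qed

text \<open>The form has degree 1 in the variables of each \<open>e \<in> F\<close> and degree 0 in
  those of the other edges; \<open>h\<close> chooses one coordinate for each edge.\<close>

lemma ex_multilinear_cpoly:
  fixes F :: "'e set" and a :: "('e \<Rightarrow> nat) \<Rightarrow> complex"
  assumes F: "finite F" "F \<subseteq> E"
  shows "\<exists>f. multihomogeneous d E f \<and>
    (\<forall>x. eval_cpoly f x = (\<Sum>h\<in>F \<rightarrow>\<^sub>E {..<d}. a h * (\<Prod>e\<in>F. x (e, h e))))"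
proof -
  define \<mu> :: "('e \<Rightarrow> nat) \<Rightarrow> ('e \<times> nat) \<Rightarrow>\<^sub>0 nat" where
    "\<mu> h = (\<Sum>e\<in>F. Poly_Mapping.single (e, h e) 1)" for h
  have lookup_\<mu>: "Poly_Mapping.lookup (\<mu> h) (e, i) = (if e \<in> F \<and> i = h e then 1 else 0)" for h e i
  proof -
    have "Poly_Mapping.lookup (\<mu> h) (e, i) = (\<Sum>e'\<in>F. if e' = e \<and> i = h e then 1 else 0)"
      unfolding \<mu>_def lookup_sum by (intro sum.cong) (auto simp: lookup_single when_def)
    also have "\<dots> = (if e \<in> F \<and> i = h e then 1 else 0)"
      using F by (cases "i = h e") simp_all
    finally show ?thesis .
  qed
  have keys_\<mu>: "Poly_Mapping.keys (\<mu> h) = (\<lambda>e. (e, h e)) ` F" for h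
    by (auto simp: in_keys_iff lookup_\<mu> split: if_splits)
  define f where "f = (\<Sum>h\<in>F \<rightarrow>\<^sub>E {..<d}. Poly_Mapping.single (\<mu> h) (a h))"
  have "eval_cpoly f x = (\<Sum>h\<in>F \<rightarrow>\<^sub>E {..<d}. a h * (\<Prod>e\<in>F. x (e, h e)))" for x
    unfolding f_def eval_cpoly_sum eval_cpoly_single keys_\<mu>
    by (subst prod.reindex) (auto simp: inj_on_def lookup_\<mu>)
  moreover have "multihomogeneous d E f"
    unfolding multihomogeneous_def
  proof (intro exI ballI conjI)
    fix \<nu> assume \<nu>: "\<nu> \<in> Poly_Mapping.keys f"
    have "Poly_Mapping.keys f \<subseteq> (\<Union>h\<in>F \<rightarrow>\<^sub>E {..<d}. Poly_Mapping.keys (Poly_Mapping.single (\<mu> h) (a h)))"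
      unfolding f_def by (rule keys_sum)
    with \<nu> obtain h where h: "h \<in> F \<rightarrow>\<^sub>E {..<d}" "\<nu> = \<mu> h"
      by (auto split: if_splits)
    then show "Poly_Mapping.keys \<nu> \<subseteq> E \<times> {..<d}" using F by (auto simp: keys_\<mu>)
    fix e assume "e \<in> E"
    show "(\<Sum>i<d. Poly_Mapping.lookup \<nu> (e, i)) = (if e \<in> F then 1 else 0)"
      using h by (auto simp: lookup_\<mu>)
  qed
  ultimately show ?thesis by blast
qed

text \<open>Column \<open>c\<close> of the matrix consists of linear forms in the variables of
  \<open>c\<close> alone, and each Leibniz term takes one entry per column, so the determinant is
  multilinear. Its nonvanishing is stated as triviality of the kernel, the form in which it is
  used.\<close>

lemma ex_determinantal_cpoly:
  fixes F :: "'e set" and m :: "'e \<Rightarrow> 'e \<Rightarrow> nat \<Rightarrow> complex"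
  assumes F: "finite F" "F \<subseteq> E"
  shows "\<exists>f. multihomogeneous d E f \<and> (\<forall>x. eval_cpoly f x \<noteq> 0 \<longleftrightarrow>
    (\<forall>t. (\<forall>r\<in>F. (\<Sum>c\<in>F. (\<Sum>j<d. m r c j * x (c, j)) * t c) = 0) \<longrightarrow> (\<forall>c\<in>F. t c = 0)))"
proof -
  obtain g where g: "bij_betw g {0..<card F} F"
    using ex_bij_betw_nat_finite[OF F(1)] by blast
  define n where "n = card F"
  have g: "bij_betw g {0..<n} F" using g by (simp add: n_def)
  define g' where "g' = the_inv_into {0..<n} g"
  have gF: "g k \<in> F" if "k < n" for k using g that by (auto simp: bij_betw_def)
  have g'g: "g' (g k) = k" if "k < n" for k
    using g that by (auto simp: g'_def bij_betw_def the_inv_into_f_f)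
  have ex_g: "\<exists>k<n. i = g k" if "i \<in> F" for i
    using bij_betw_imp_surj_on[OF g] that by fastforce
  define M where "M x = mat n n (\<lambda>(r, c). \<Sum>j<d. m (g r) (g c) j * x (g c, j))" for x
  have M: "M x \<in> carrier_mat n n" for x by (simp add: M_def)
  define a where "a h = (\<Sum>p | p permutes {0..<n}.
    signof p * (\<Prod>c\<in>F. m (g (p (g' c))) c (h c)))" for h
  have det_M: "det (M x) = (\<Sum>h\<in>F \<rightarrow>\<^sub>E {..<d}. a h * (\<Prod>e\<in>F. x (e, h e)))" for x
  proof -
    \<comment> \<open>After transposing, the Leibniz products run over the columns, which carry the
      groups of variables.\<close>
    have "det (M x) = det (transpose_mat (M x))" using det_transpose[OF M] by simp
    also have "\<dots> = (\<Sum>p | p permutes {0..<n}. signof p *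
        (\<Prod>k = 0..<n. \<Sum>j<d. m (g (p k)) (g k) j * x (g k, j)))"
    proof (subst det_def'[of _ n], goal_cases)
      case 2
      have "p k < n" if "p permutes {0..<n}" "k < n" for p k
        using permutes_in_image[OF that(1), of k] that(2) by simp
      then show ?case by (intro sum.cong arg_cong2[of _ _ _ _ "(*)"] prod.cong) (auto simp: M_def)
    qed (simp add: M)
    also have "\<dots> = (\<Sum>p | p permutes {0..<n}. signof p *
        (\<Prod>c\<in>F. \<Sum>j<d. m (g (p (g' c))) c j * x (c, j)))"
      unfolding prod.reindex_bij_betw[OF g, symmetric]
      by (intro sum.cong arg_cong2[of _ _ _ _ "(*)"] prod.cong) (auto simp: g'g)
    also have "\<dots> = (\<Sum>p | p permutes {0..<n}. signof p *
        (\<Sum>h\<in>F \<rightarrow>\<^sub>E {..<d}. \<Prod>c\<in>F. m (g (p (g' c))) c (h c) * x (c, h c)))"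
      using F by (subst prod_sum_PiE) auto
    also have "\<dots> = (\<Sum>h\<in>F \<rightarrow>\<^sub>E {..<d}. a h * (\<Prod>e\<in>F. x (e, h e)))"
      unfolding a_def sum_distrib_left sum_distrib_right prod.distrib
      by (subst sum.swap) (simp add: mult.assoc)
    finally show ?thesis .
  qed
  have "det (M x) \<noteq> 0 \<longleftrightarrow>
    (\<forall>t. (\<forall>r\<in>F. (\<Sum>c\<in>F. (\<Sum>j<d. m r c j * x (c, j)) * t c) = 0) \<longrightarrow> (\<forall>c\<in>F. t c = 0))" for x
  proof -
    have mult: "(M x *\<^sub>v v) $ r = (\<Sum>k = 0..<n. (\<Sum>j<d. m (g r) (g k) j * x (g k, j)) * v $ k)"
      if "r < n" "v \<in> carrier_vec n" for r v
      using that by (simp add: M_def scalar_prod_def)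
    show ?thesis (is "_ \<longleftrightarrow> ?R")
    proof
      assume det: "det (M x) \<noteq> 0"
      show ?R
      proof (intro allI impI)
        fix t assume t: "\<forall>r\<in>F. (\<Sum>c\<in>F. (\<Sum>j<d. m r c j * x (c, j)) * t c) = 0"
        let ?v = "vec n (\<lambda>k. t (g k))"
        have "M x *\<^sub>v ?v = 0\<^sub>v n"
        proof (rule eq_vecI)
          fix r assume "r < dim_vec (0\<^sub>v n)"
          then have r: "r < n" by simp
          have "(M x *\<^sub>v ?v) $ r = (\<Sum>k = 0..<n. (\<Sum>j<d. m (g r) (g k) j * x (g k, j)) * t (g k))"
            by (subst mult[OF r]) (auto intro!: sum.cong)
          also have "\<dots> = 0" using t gF[OF r] by (simp add: sum_enumerate[OF g])
          finally show "(M x *\<^sub>v ?v) $ r = 0\<^sub>v n $ r" using r by simp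
        qed (simp add: M_def)
        then have "?v = 0\<^sub>v n"
          using det det_0_iff_vec_prod_zero_field[OF M] by (metis vec_carrier)
        then have "t (g k) = 0" if "k < n" for k
          using that by (metis index_vec index_zero_vec(1))
        then show "\<forall>c\<in>F. t c = 0" using ex_g by blast
      qed
    next
      assume R: ?R
      show "det (M x) \<noteq> 0"
      proof
        assume "det (M x) = 0"
        then obtain v where v: "v \<in> carrier_vec n" "v \<noteq> 0\<^sub>v n" "M x *\<^sub>v v = 0\<^sub>v n"
          using det_0_iff_vec_prod_zero_field[OF M] by blast
        have "(\<Sum>c\<in>F. (\<Sum>j<d. m r c j * x (c, j)) * v $ g' c) = 0" if "r \<in> F" for r
        proof -
          obtain k where k: "k < n" "r = g k" using ex_g[OF \<open>r \<in> F\<close>] by blast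
          have "(\<Sum>c\<in>F. (\<Sum>j<d. m r c j * x (c, j)) * v $ g' c) = (M x *\<^sub>v v) $ k"
            unfolding sum_enumerate[OF g] mult[OF k(1) v(1)] k(2)
            by (intro sum.cong) (auto simp: g'g)
          then show ?thesis using v(3) k by simp
        qed
        then have "\<forall>c\<in>F. v $ g' c = 0" using R[THEN spec, of "\<lambda>c. v $ g' c"] by blast
        then have "v $ k = 0" if "k < n" for k using gF[OF that] g'g[OF that] by auto
        then have "v = 0\<^sub>v n" using v(1) by (intro eq_vecI) auto
        then show False using v(2) by simp
      qed
    qed
  qed
  moreover obtain f where "multihomogeneous d E f"
    "\<And>x. eval_cpoly f x = (\<Sum>h\<in>F \<rightarrow>\<^sub>E {..<d}. a h * (\<Prod>e\<in>F. x (e, h e)))"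
    using ex_multilinear_cpoly[OF F, of d a] by blast
  ultimately show ?thesis
    using det_M by (intro exI[of _ f]) simp
qed

subsection \<open>Realising generic directions\<close>

context oriented_multigraph
begin

text \<open>For \<open>d > 0\<close> and a connected \<open>F\<close> on \<open>k\<close> vertices
  this says \<open>(d - 1) * card F \<le> d * k - (d + 1)\<close> over the integers: a prescribed
  direction costs \<open>d - 1\<close> linear conditions, and translations and scalings account for
  \<open>d + 1\<close> parameters.\<close>

definition sparse :: "nat \<Rightarrow> bool" where
  "sparse d \<longleftrightarrow> (\<forall>F\<subseteq>E. F \<noteq> {} \<longrightarrow> (d - 1) * card F < d * rank F)"

lemma ex_forest_covering:
  assumes sparse: "sparse d" and d: "d > 0" and e: "e \<in> E"
  shows "\<exists>T i. (\<forall>j<d. T j \<subseteq> E \<and> card (T j) \<le> rank (T j) \<and> e \<in> T j) \<and>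
    (\<forall>f\<in>E. i f < d \<and> (\<forall>j<d. j \<noteq> i f \<longrightarrow> f \<in> T j))"
proof -
  \<comment> \<open>Rado's theorem assigns to each of the \<open>d - 1\<close> copies of an edge, and to the additional copy
    of \<open>e\<close>, one of \<open>d\<close> forests.\<close>
  define I where "I = insert (e, d - 1) (E \<times> {..<d - 1})"
  define S :: "'e \<times> nat \<Rightarrow> ('e \<times> nat) set" where "S a = {fst a} \<times> {..<d}" for a
  define fibre :: "('e \<times> nat) set \<Rightarrow> nat \<Rightarrow> 'e set" where "fibre X j = {f. (f, j) \<in> X}" for X j
  \<comment> \<open>The rank function of the direct sum of \<open>d\<close> copies of the cycle
    matroid.\<close>
  define \<rho> where "\<rho> X = (\<Sum>j<d. rank (fibre X j))" for X
  have sec: "fibre A j \<subseteq> E" if "A \<subseteq> E \<times> {..<d}" for A j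
    using that by (auto simp: fibre_def)
  have I: "finite I" "card I = (d - 1) * card E + 1"
    by (auto simp: I_def card_cartesian_product)
  have "\<exists>s. (\<forall>a\<in>I. s a \<in> S a) \<and> card I \<le> \<rho> (s ` I)"
  proof (rule rado_transversal)
    show "finite (E \<times> {..<d})" by simp
    show "\<rho> {} = 0" by (simp add: \<rho>_def fibre_def)
    show "\<rho> A \<le> \<rho> B" if "A \<subseteq> B" "B \<subseteq> E \<times> {..<d}" for A B
      unfolding \<rho>_def using that sec by (intro sum_mono rank_mono) (auto simp: fibre_def)
    show "\<rho> (A \<union> B) + \<rho> (A \<inter> B) \<le> \<rho> A + \<rho> B"
      if "A \<subseteq> E \<times> {..<d}" "B \<subseteq> E \<times> {..<d}" for A B
    proof -
      have "fibre (A \<union> B) j = fibre A j \<union> fibre B j"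
        "fibre (A \<inter> B) j = fibre A j \<inter> fibre B j" for j
        by (auto simp: fibre_def)
      then show ?thesis
        unfolding \<rho>_def sum.distrib[symmetric]
        using rank_submodular[OF sec[OF that(1)] sec[OF that(2)]] by (auto intro!: sum_mono)
    qed
    show "S a \<subseteq> E \<times> {..<d}" if "a \<in> I" for a
      using that e by (auto simp: S_def I_def)
    fix J assume J: "J \<subseteq> I"
    define F where "F = fst ` J"
    have F: "F \<subseteq> E" using J e by (auto simp: F_def I_def)
    have "fibre (\<Union>a\<in>J. S a) j = F" if "j < d" for j
      using that by (auto simp: fibre_def S_def F_def)
    then have \<rho>J: "\<rho> (\<Union>a\<in>J. S a) = d * rank F" by (simp add: \<rho>_def)
    \<comment> \<open>\<open>J\<close> has at most \<open>(d - 1) * card F + 1\<close> elements, the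
      1 being the additional copy of \<open>e\<close>; the strictness of the count pays for
      it.\<close>
    show "card J \<le> \<rho> (\<Union>a\<in>J. S a)"
    proof (cases "J = {}")
      case False
      then have "F \<noteq> {}" by (simp add: F_def)
      then have "(d - 1) * card F < d * rank F" using sparse F by (simp add: sparse_def)
      moreover have "J \<subseteq> insert (e, d - 1) (F \<times> {..<d - 1})"
        using J by (force simp: I_def F_def)
      then have "card J \<le> card (insert (e, d - 1) (F \<times> {..<d - 1}))"
        using finite_edge_set[OF F] by (intro card_mono) auto
      then have "card J \<le> (d - 1) * card F + 1"
        using finite_edge_set[OF F] by (simp add: card_cartesian_product mult.commute)
      ultimately show ?thesis using \<rho>J by linarith
    qed simp
  qed (rule I)
  then obtain s where sS: "\<And>a. a \<in> I \<Longrightarrow> s a \<in> S a" and s\<rho>: "card I \<le> \<rho> (s ` I)" by blast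
  define T where "T = fibre (s ` I)"
  have sU: "s ` I \<subseteq> E \<times> {..<d}" using sS e by (force simp: S_def I_def)
  have TE: "T j \<subseteq> E" for j using sec[OF sU] by (simp add: T_def)
  have finT: "finite (T j)" for j using TE finite_edge_set by blast
  have "s ` I = (\<lambda>(j, f). (f, j)) ` Sigma {..<d} T"
    using sU by (force simp: T_def fibre_def image_iff)
  then have card_sI: "card (s ` I) = (\<Sum>j<d. card (T j))"
    using finT by (simp add: card_image inj_on_def card_SigmaI split: prod.split)
  \<comment> \<open>Ranks are at most sizes, and the image of \<open>s\<close> is at most as large
    as \<open>I\<close>. Rado's bound forces equality throughout: every \<open>T j\<close> is a
    forest and \<open>s\<close> is injective.\<close>
  have le: "(\<Sum>j<d. rank (T j)) \<le> (\<Sum>j<d. card (T j))"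
    using TE by (intro sum_mono rank_le_card)
  have cI: "card (s ` I) \<le> card I" using I by (intro card_image_le)
  have "(\<Sum>j<d. rank (T j)) = (\<Sum>j<d. card (T j))" "card (s ` I) = card I"
    using le cI card_sI s\<rho> unfolding \<rho>_def T_def by linarith+
  then have rankT: "rank (T j) = card (T j)" if "j < d" for j
    using that TE sum_mono_inv[of "\<lambda>j. rank (T j)" "{..<d}" "\<lambda>j. card (T j)" j] rank_le_card by auto
  have inj: "inj_on s I" using I \<open>card (s ` I) = card I\<close> by (simp add: eq_card_imp_inj_on)
  have s_eq: "s (f, k) = (f, snd (s (f, k)))" "snd (s (f, k)) < d" if "(f, k) \<in> I" for f k
    using sS[OF that] by (auto simp: S_def mem_Times_iff prod_eq_iff)
  \<comment> \<open>By injectivity, different copies of an edge are placed in different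
    forests.\<close>
  have colours: "card K \<le> card {j. j < d \<and> f \<in> T j}" if K: "{f} \<times> K \<subseteq> I" for f K
  proof -
    have "card K = card ((\<lambda>k. snd (s (f, k))) ` K)"
    proof (rule card_image[symmetric], rule inj_onI)
      fix k l assume kl: "k \<in> K" "l \<in> K" "snd (s (f, k)) = snd (s (f, l))"
      then have "(f, k) \<in> I" "(f, l) \<in> I" using K by auto
      then have "s (f, k) = s (f, l)" using s_eq(1) kl(3) by metis
      then show "k = l" using inj kl K by (auto simp: inj_on_def)
    qed
    also have "\<dots> \<le> card {j. j < d \<and> f \<in> T j}"
    proof (rule card_mono)
      show "(\<lambda>k. snd (s (f, k))) ` K \<subseteq> {j. j < d \<and> f \<in> T j}"
        using s_eq K by (fastforce simp: T_def fibre_def image_iff)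
    qed simp
    finally show ?thesis .
  qed
  have "\<exists>i<d. \<forall>j<d. j \<noteq> i \<longrightarrow> f \<in> T j" if "f \<in> E" for f
  proof -
    \<comment> \<open>The forests that miss \<open>f\<close>: the \<open>d - 1\<close> placed copies
      leave at most one. If there is none, any index can serve as \<open>i f\<close>.\<close>
    define N where "N = {j. j < d \<and> f \<notin> T j}"
    have "card {..<d - 1} \<le> card {j. j < d \<and> f \<in> T j}"
      using that by (intro colours) (auto simp: I_def)
    moreover have "card ({j. j < d \<and> f \<in> T j} \<union> N) = card {j. j < d \<and> f \<in> T j} + card N"
      by (rule card_Un_disjoint) (auto simp: N_def)
    moreover have "{j. j < d \<and> f \<in> T j} \<union> N = {..<d}" by (auto simp: N_def)
    ultimately have N1: "card N \<le> 1" using d by simp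
    have "finite N" by (simp add: N_def)
    show ?thesis
    proof (cases "N = {}")
      case True
      then show ?thesis using d by (auto simp: N_def)
    next
      case False
      then obtain i where i: "i \<in> N" by auto
      have "N = {i}" using N1 i \<open>finite N\<close> card_le_Suc0_iff_eq[of N] by auto
      then show ?thesis by (intro exI[of _ i]) (auto simp: N_def)
    qed
  qed
  then obtain i where i: "\<And>f. f \<in> E \<Longrightarrow> i f < d \<and> (\<forall>j<d. j \<noteq> i f \<longrightarrow> f \<in> T j)" by metis
  have "e \<in> T j" if "j < d" for j
  proof -
    have "card {..<d} \<le> card {j. j < d \<and> e \<in> T j}"
      using e d by (intro colours) (auto simp: I_def)
    then have "{j. j < d \<and> e \<in> T j} = {..<d}" by (intro card_seteq) auto
    then show ?thesis using that by auto
  qed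
  then show ?thesis using i TE rankT by (intro exI[of _ T] exI[of _ i]) auto
qed

text \<open>\<open>W\<close> collects the directions with nonzero pivots \<open>x (f, i f)\<close>
  whose linear system is solvable for every right-hand side. Surjectivity, unlike solvability for a
  single right-hand side, persists along lines up to finitely many parameters; it holds at the
  coordinate directions given by the forests.\<close>

lemma ex_line_open_realisable_edge:
  assumes sparse: "sparse d" and d: "d > 0" and e: "e \<in> E"
  shows "\<exists>W. line_open W \<and> W \<noteq> {} \<and> (\<forall>x\<in>W. \<exists>(p :: 'v \<Rightarrow> nat \<Rightarrow> complex) t. t e = 1 \<and>
    (\<forall>f\<in>E. \<forall>j<d. p (src f) j - p (tgt f) j = t f * x (f, j)))"
proof -
  from ex_forest_covering[OF assms] obtain T i
    where T: "\<forall>j<d. T j \<subseteq> E \<and> card (T j) \<le> rank (T j) \<and> e \<in> T j"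
      and i: "\<forall>f\<in>E. i f < d \<and> (\<forall>j<d. j \<noteq> i f \<longrightarrow> f \<in> T j)"
    by (elim exE conjE)
  note T = T[rule_format] and i = i[rule_format]
  \<comment> \<open>An edge \<open>f \<noteq> e\<close> contributes the \<open>d - 1\<close>
    equations off its pivot \<open>i f\<close>; for \<open>e\<close> all \<open>d\<close>
    coordinates are prescribed.\<close>
  define I where "I = {(f, j). f \<in> E \<and> j < d \<and> (f = e \<or> j \<noteq> i f)}"
  have "I \<subseteq> E \<times> {..<d}" by (auto simp: I_def)
  then have finI: "finite I" by (rule finite_subset) simp
  define \<delta> where "\<delta> p f j = p (src f) j - p (tgt f) j" for p :: "'v \<Rightarrow> nat \<Rightarrow> complex" and f j
  \<comment> \<open>For \<open>f \<noteq> e\<close> the entries \<open>(f, j)\<close> say that \<open>\<delta> p f\<close> is parallel to \<open>x f\<close> as long as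
    \<open>x (f, i f) \<noteq> 0\<close>; they are linear in \<open>p\<close> and, for fixed \<open>p\<close>, affine in \<open>x\<close>.\<close>
  define A where "A x p a = (case a of (f, j) \<Rightarrow>
    if f = e then \<delta> p f j else x (f, i f) * \<delta> p f j - x (f, j) * \<delta> p f (i f))"
    for x :: "'e \<times> nat \<Rightarrow> complex" and p a
  define W where "W = {x. (\<forall>f\<in>E. x (f, i f) \<noteq> 0) \<and> (\<forall>c. \<exists>p. \<forall>a\<in>I. A x p a = c a)}"
  have surj: "\<exists>p. \<forall>a\<in>I. A x p a = c a" if "x \<in> W" for x c
    using that by (simp add: W_def)
  have "line_open W"
    unfolding line_open_def
  proof (intro ballI allI)
    fix x y assume x: "x \<in> W"
    \<comment> \<open>\<open>b a\<close> solves the system for the unit vector at \<open>a\<close>.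
      On combinations of these solutions the system is the identity at \<open>x\<close> and the
      identity plus \<open>s C\<close> at \<open>x + s y\<close>.\<close>
    have "\<exists>p. \<forall>a'\<in>I. A x p a' = (if a' = a then 1 else 0)" for a
      using surj[OF x, of "\<lambda>a'. if a' = a then 1 else 0"] .
    then obtain b where b: "\<And>a a'. a' \<in> I \<Longrightarrow> A x (b a) a' = (if a' = a then 1 else 0)" by metis
    define C where "C a' a = (case a' of (f, j) \<Rightarrow>
      if f = e then 0 else y (f, i f) * \<delta> (b a) f j - y (f, j) * \<delta> (b a) f (i f))" for a' a
    let ?z = "\<lambda>s k. x k + s * y k"
    let ?B = "{s. \<not> (\<forall>c. \<exists>t. \<forall>a\<in>I. t a + s * (\<Sum>a'\<in>I. C a a' * t a') = c a)}"
    have comb: "\<exists>p. \<forall>a\<in>I. A (?z s) p a = t a + s * (\<Sum>a'\<in>I. C a a' * t a')" for s t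
    proof -
      define p where "p v j = (\<Sum>a\<in>I. t a * b a v j)" for v j
      have \<delta>p: "\<delta> p f j = (\<Sum>a\<in>I. t a * \<delta> (b a) f j)" for f j
        by (simp add: \<delta>_def p_def sum_subtractf[symmetric] right_diff_distrib)
      have A_comb: "A X p a = (\<Sum>a'\<in>I. t a' * A X (b a') a)" for X a
        by (cases a)
          (simp add: A_def \<delta>p sum_subtractf sum_distrib_left right_diff_distrib mult.left_commute)
      have *: "(\<Sum>a'\<in>I. t a' * A (?z s) (b a') a) = (\<Sum>a'\<in>I. t a' * A x (b a') a + s * (C a a' * t a'))" for a
        by (intro sum.cong) (auto simp: A_def C_def algebra_simps split: prod.split)
      have "A (?z s) p a = t a + s * (\<Sum>a'\<in>I. C a a' * t a')" if "a \<in> I" for a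
      proof -
        have "(\<Sum>a'\<in>I. t a' * A x (b a') a) = (\<Sum>a'\<in>I. if a' = a then t a' else 0)"
          by (intro sum.cong) (auto simp: b[OF that])
        then have "(\<Sum>a'\<in>I. t a' * A x (b a') a) = t a" using finI that by simp
        then show ?thesis unfolding A_comb *[of a] by (simp add: sum.distrib sum_distrib_left)
      qed
      then show ?thesis by blast
    qed
    have "{s. ?z s \<notin> W} \<subseteq> (\<Union>f\<in>E. {s. x (f, i f) + s * y (f, i f) = 0}) \<union> ?B"
    proof (rule subsetI, rule ccontr)
      fix s assume s: "s \<in> {s. ?z s \<notin> W}"
        "s \<notin> (\<Union>f\<in>E. {s. x (f, i f) + s * y (f, i f) = 0}) \<union> ?B"
      have "\<exists>p. \<forall>a\<in>I. A (?z s) p a = c a" for c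
      proof -
        from s obtain t where "\<forall>a\<in>I. t a + s * (\<Sum>a'\<in>I. C a a' * t a') = c a" by blast
        then show ?thesis using comb[of s t] by auto
      qed
      then have "?z s \<in> W" using s by (auto simp: W_def)
      then show False using s by simp
    qed
    moreover have "finite ((\<Union>f\<in>E. {s. x (f, i f) + s * y (f, i f) = 0}) \<union> ?B)"
      using x finite_singular_perturbations[OF finI, of C] finite_affine_zeros
      by (auto simp: W_def)
    ultimately show "finite {s. ?z s \<notin> W}" by (rule finite_subset)
  qed
  \<comment> \<open>Along coordinate directions the equations decouple: entry \<open>(f, j)\<close>
    becomes \<open>\<delta> p f j\<close>, and in coordinate \<open>j\<close> only edges of the
    forest \<open>T j\<close> occur, which potentials separate from each other.\<close>
  moreover have "(\<lambda>(f, j). if j = i f then 1 else 0) \<in> W" (is "?x \<in> W")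
  proof -
    have "\<exists>q :: 'v \<Rightarrow> complex. \<forall>g\<in>T j. q (src g) - q (tgt g) = (if g = f then 1 else 0)"
      if "(f, j) \<in> I" for f j
      using that T[of j] i[of f] by (intro ex_separating_potential) (auto simp: I_def)
    then obtain q :: "'e \<Rightarrow> nat \<Rightarrow> 'v \<Rightarrow> complex" where
      q: "\<And>f j g. (f, j) \<in> I \<Longrightarrow> g \<in> T j \<Longrightarrow>
        q f j (src g) - q f j (tgt g) = (if g = f then 1 else 0)" by metis
    have "\<exists>p. \<forall>a\<in>I. A ?x p a = c a" for c
    proof -
      define p where "p v j = (\<Sum>f | (f, j) \<in> I. c (f, j) * q f j v)" for v j
      have "\<delta> p g j = c (g, j)" if gj: "(g, j) \<in> I" for g j
      proof -
        have "g \<in> T j" using gj T[of j] i[of g] by (auto simp: I_def)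
        have fin: "finite {f. (f, j) \<in> I}"
          by (rule finite_subset[OF _ finite_E]) (auto simp: I_def)
        have "\<delta> p g j = (\<Sum>f | (f, j) \<in> I. c (f, j) * (q f j (src g) - q f j (tgt g)))"
          by (simp add: \<delta>_def p_def sum_subtractf[symmetric] right_diff_distrib)
        also have "\<dots> = (\<Sum>f | (f, j) \<in> I. if g = f then c (f, j) else 0)"
          using q \<open>g \<in> T j\<close> by (intro sum.cong) auto
        also have "\<dots> = c (g, j)" using gj fin by simp
        finally show ?thesis .
      qed
      then have "A ?x p a = c a" if "a \<in> I" for a
        using that by (cases a) (auto simp: A_def I_def)
      then show ?thesis by blast
    qed
    then show ?thesis by (auto simp: W_def)
  qed
  moreover have "\<exists>(p :: 'v \<Rightarrow> nat \<Rightarrow> complex) t. t e = 1 \<and>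
    (\<forall>f\<in>E. \<forall>j<d. p (src f) j - p (tgt f) j = t f * x (f, j))" if x: "x \<in> W" for x
  proof -
    \<comment> \<open>This right-hand side places \<open>e\<close> with factor 1 and asks every
      other edge to be parallel to its direction; the factor of such an edge is then read off at its
      pivot.\<close>
    obtain p where p: "\<forall>a\<in>I. A x p a = (if fst a = e then x a else 0)"
      using surj[OF x, of "\<lambda>a. if fst a = e then x a else 0"] by (elim exE)
    define t where "t f = (if f = e then 1 else \<delta> p f (i f) / x (f, i f))" for f
    have "\<delta> p f j = t f * x (f, j)" if f: "f \<in> E" "j < d" for f j
    proof (cases "f \<noteq> e \<and> j = i f")
      case True
      then show ?thesis using x f by (auto simp: t_def W_def)
    next
      case False
      then have "(f, j) \<in> I" using f by (auto simp: I_def)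
      then have "A x p (f, j) = (if f = e then x (f, j) else 0)" using p by auto
      then show ?thesis using x f by (auto simp: A_def t_def W_def field_simps)
    qed
    then show ?thesis by (intro exI[of _ p] exI[of _ t]) (auto simp: t_def \<delta>_def)
  qed
  ultimately show ?thesis by blast
qed

text \<open>The realisations belonging to the single edges are superposed with coefficients
  \<open>c\<close>. The factor of \<open>f\<close> is a linear form in \<open>c\<close>, nonzero
  because the realisation for \<open>f\<close> has factor 1 at \<open>f\<close>, so some
  \<open>c\<close> makes all factors nonzero at once.\<close>

lemma ex_line_open_realisable:
  assumes sparse: "sparse d" and d: "d > 0"
  shows "\<exists>W. line_open W \<and> W \<noteq> {} \<and> (\<forall>x\<in>W. \<exists>(p :: 'v \<Rightarrow> nat \<Rightarrow> complex) t. (\<forall>f\<in>E. t f \<noteq> 0) \<and>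
    (\<forall>f\<in>E. \<forall>j<d. p (src f) j - p (tgt f) j = t f * x (f, j)))"
proof -
  from ex_line_open_realisable_edge[OF assms] have
    "\<forall>e. \<exists>W. e \<in> E \<longrightarrow> line_open W \<and> W \<noteq> {} \<and> (\<forall>x\<in>W. \<exists>(p :: 'v \<Rightarrow> nat \<Rightarrow> complex) t. t e = 1 \<and>
    (\<forall>f\<in>E. \<forall>j<d. p (src f) j - p (tgt f) j = t f * x (f, j)))" by blast
  then obtain W where W: "\<And>e. e \<in> E \<Longrightarrow> line_open (W e)" "\<And>e. e \<in> E \<Longrightarrow> W e \<noteq> {}"
    and real: "\<And>e x. e \<in> E \<Longrightarrow> x \<in> W e \<Longrightarrow> \<exists>(p :: 'v \<Rightarrow> nat \<Rightarrow> complex) t. t e = 1 \<and>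
    (\<forall>f\<in>E. \<forall>j<d. p (src f) j - p (tgt f) j = t f * x (f, j))" by metis
  have "\<exists>(p :: 'v \<Rightarrow> nat \<Rightarrow> complex) t. (\<forall>f\<in>E. t f \<noteq> 0) \<and>
    (\<forall>f\<in>E. \<forall>j<d. p (src f) j - p (tgt f) j = t f * x (f, j))" if x: "x \<in> (\<Inter>e\<in>E. W e)" for x
  proof -
    have "\<forall>e. \<exists>(p :: 'v \<Rightarrow> nat \<Rightarrow> complex) t. e \<in> E \<longrightarrow> t e = 1 \<and>
      (\<forall>f\<in>E. \<forall>j<d. p (src f) j - p (tgt f) j = t f * x (f, j))" using real x by blast
    then obtain P :: "'e \<Rightarrow> 'v \<Rightarrow> nat \<Rightarrow> complex" and T where T1: "\<And>e. e \<in> E \<Longrightarrow> T e e = 1" and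
      P: "\<And>e f j. e \<in> E \<Longrightarrow> f \<in> E \<Longrightarrow> j < d \<Longrightarrow> P e (src f) j - P e (tgt f) j = T e f * x (f, j)"
      by metis
    let ?t = "\<lambda>c f. \<Sum>e\<in>E. c e * T e f"
    have "(\<Inter>f\<in>E. {c. ?t c f \<noteq> 0}) \<noteq> {}"
    proof (rule line_open_INT[THEN conjunct2])
      fix f assume f: "f \<in> E"
      show "line_open {c. ?t c f \<noteq> 0}"
        by (rule line_open_linear_nonzero) (simp add: algebra_simps sum.distrib sum_distrib_left)
      have "?t (\<lambda>e. if e = f then 1 else 0) f = 1"
        using f T1 by (simp add: if_distrib[of "\<lambda>x. x * _"] cong: if_cong)
      then have mem: "(\<lambda>e. if e = f then 1 else 0) \<in> {c. ?t c f \<noteq> 0}" by simp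
      show "{c. ?t c f \<noteq> 0} \<noteq> {}"
      proof
        assume empty: "{c. ?t c f \<noteq> 0} = {}"
        show False using mem unfolding empty by simp
      qed
    qed simp
    then obtain c where c: "\<And>f. f \<in> E \<Longrightarrow> ?t c f \<noteq> 0" by auto
    define p where "p v j = (\<Sum>e\<in>E. c e * P e v j)" for v j
    have "p (src f) j - p (tgt f) j = ?t c f * x (f, j)" if "f \<in> E" "j < d" for f j
    proof -
      have "p (src f) j - p (tgt f) j = (\<Sum>e\<in>E. c e * (P e (src f) j - P e (tgt f) j))"
        by (simp add: p_def sum_subtractf[symmetric] right_diff_distrib)
      then show ?thesis using P that by (simp add: sum_distrib_right mult.assoc)
    qed
    then show ?thesis using c by (intro exI[of _ p] exI[of _ "?t c"]) simp
  qed
  then show ?thesis using line_open_INT[of E W] W by (intro exI[of _ "\<Inter>e\<in>E. W e"]) auto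
qed

end

subsection \<open>Dependence of violating edge sets\<close>

lemma proj_class_self: "x \<in> proj_class x"
  by (auto simp: proj_class_def intro!: exI[of _ 1])

lemma proj_class_uminus: "proj_class (- x) = proj_class x"
proof -
  have "proj_class (- x) \<subseteq> proj_class x" for x
  proof
    fix y assume "y \<in> proj_class (- x)"
    then obtain c where "c \<noteq> 0" "y = c \<cdot>\<^sub>v (- x)" by (auto simp: proj_class_def)
    then have "- c \<noteq> 0" "y = (- c) \<cdot>\<^sub>v x" by auto
    then show "y \<in> proj_class x" unfolding proj_class_def by blast
  qed
  from this[of x] this[of "- x"] show ?thesis by simp
qed

text \<open>A closed set is an intersection of zero loci of single forms, so density can be tested
  against one form at a time.\<close>

lemma zariski_dense_iff:
  "zariski_dense d E A \<longleftrightarrow> (\<forall>f. multihomogeneous d E f \<and> A \<subseteq> zero_locus d E {f} \<longrightarrow>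
     proj_power d E \<subseteq> zero_locus d E {f})" if "A \<subseteq> proj_power d E"
proof
  assume dense: "zariski_dense d E A"
  show "\<forall>f. multihomogeneous d E f \<and> A \<subseteq> zero_locus d E {f} \<longrightarrow>
     proj_power d E \<subseteq> zero_locus d E {f}"
  proof (intro allI impI)
    fix f assume f: "multihomogeneous d E f \<and> A \<subseteq> zero_locus d E {f}"
    then have "zariski_closed d E (zero_locus d E {f})"
      unfolding zariski_closed_def by (intro exI[of _ "{f}"]) auto
    then have "zariski_closed d E hull A \<subseteq> zero_locus d E {f}"
      using f that by (intro hull_minimal) auto
    then show "proj_power d E \<subseteq> zero_locus d E {f}"
      using dense by (simp add: zariski_dense_def)
  qed
next
  assume *: "\<forall>f. multihomogeneous d E f \<and> A \<subseteq> zero_locus d E {f} \<longrightarrow>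
     proj_power d E \<subseteq> zero_locus d E {f}"
  have "proj_power d E \<subseteq> Z" if "zariski_closed d E Z" "A \<subseteq> Z" for Z
  proof -
    obtain S where S: "\<And>f. f \<in> S \<Longrightarrow> multihomogeneous d E f" "Z = zero_locus d E S"
      using \<open>zariski_closed d E Z\<close> by (auto simp: zariski_closed_def)
    have "proj_power d E \<subseteq> zero_locus d E {f}" if "f \<in> S" for f
    proof -
      have "A \<subseteq> zero_locus d E {f}"
        using \<open>A \<subseteq> Z\<close> that unfolding S(2) zero_locus_def by blast
      then show ?thesis using * S(1)[OF that] by blast
    qed
    then show ?thesis unfolding S(2) unfolding zero_locus_def by blast
  qed
  then have "proj_power d E \<subseteq> zariski_closed d E hull A"
    by (auto simp: hull_def)
  moreover have "zariski_closed d E (proj_power d E)"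
    unfolding zariski_closed_def by (intro exI[of _ "{}"]) (auto simp: zero_locus_def)
  then have "zariski_closed d E hull A \<subseteq> proj_power d E"
    using that by (intro hull_minimal)
  ultimately show "zariski_dense d E A" by (simp add: zariski_dense_def)
qed

context oriented_multigraph
begin

text \<open>Rado's theorem for the dual of the cycle matroid on \<open>F\<close> sorts
  \<open>F\<close> into \<open>d\<close> classes, each independent in the dual. The complement of
  such a class spans \<open>F\<close>, hence joins the ends of every edge in the class.\<close>

lemma ex_cobasis_covering:
  assumes F: "F \<subseteq> E"
    and le: "\<And>A. A \<subseteq> F \<Longrightarrow> d * (rank F - rank (F - A)) \<le> (d - 1) * card A"
    and d: "d > 0"
  shows "\<exists>i. \<forall>f\<in>F. i f < d \<and> (src f, tgt f) \<in> conn {g \<in> F. i g \<noteq> i f}"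
proof -
  define S :: "'e \<Rightarrow> ('e \<times> nat) set" where "S f = {f} \<times> {..<d}" for f
  define fibre :: "('e \<times> nat) set \<Rightarrow> nat \<Rightarrow> 'e set" where "fibre X j = {f. (f, j) \<in> X}" for X j
  \<comment> \<open>The rank function of that dual matroid.\<close>
  define corank where "corank A = card A + rank (F - A) - rank F" for A
  define \<rho> where "\<rho> X = (\<Sum>j<d. corank (fibre X j))" for X
  have finF: "finite F" by (rule finite_edge_set[OF F])
  have rank_F_le: "rank F \<le> card A + rank (F - A)" if "A \<subseteq> F" for A
  proof -
    have "rank (F - A \<union> A) \<le> rank (F - A) + card A"
      using that F finite_subset[OF that finF] by (intro rank_union_le[THEN conjunct2]) auto
    then show ?thesis using that by (simp add: Un_absorb2)
  qed
  have corank_add: "corank A + rank F = card A + rank (F - A)" if "A \<subseteq> F" for A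
    using rank_F_le[OF that] by (simp add: corank_def)
  have corank_mono: "corank A \<le> corank B" if "A \<subseteq> B" "B \<subseteq> F" for A B
  proof -
    have fin: "finite B" "finite (B - A)" using that finF finite_subset by blast+
    have "F - A = (F - B) \<union> (B - A)" using that by auto
    then have "rank (F - A) \<le> rank (F - B) + card (B - A)"
      using rank_union_le[of "B - A" "F - B"] F that fin by auto
    moreover have "card B = card A + card (B - A)"
      using that fin by (metis card_Diff_subset card_mono finite_subset le_add_diff_inverse)
    ultimately show ?thesis unfolding corank_def by linarith
  qed
  have corank_submodular: "corank (A \<union> B) + corank (A \<inter> B) \<le> corank A + corank B"
    if "A \<subseteq> F" "B \<subseteq> F" for A B
  proof -
    have fin: "finite A" "finite B" using that finF finite_subset by blast+
    have "F - (A \<union> B) = (F - A) \<inter> (F - B)" "F - (A \<inter> B) = (F - A) \<union> (F - B)" by auto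
    then have "rank (F - (A \<inter> B)) + rank (F - (A \<union> B)) \<le> rank (F - A) + rank (F - B)"
      using rank_submodular[of "F - A" "F - B"] F by auto
    moreover have "corank (A \<union> B) + rank F = card (A \<union> B) + rank (F - (A \<union> B))"
      "corank (A \<inter> B) + rank F = card (A \<inter> B) + rank (F - (A \<inter> B))"
      using that by (auto intro!: corank_add)
    ultimately show ?thesis
      using corank_add[OF that(1)] corank_add[OF that(2)] card_Un_Int[OF fin] by linarith
  qed
  have fib: "fibre A j \<subseteq> F" if "A \<subseteq> F \<times> {..<d}" for A j
    using that by (auto simp: fibre_def)
  have "\<exists>s. (\<forall>f\<in>F. s f \<in> S f) \<and> card F \<le> \<rho> (s ` F)"
  proof (rule rado_transversal)
    show "finite (F \<times> {..<d})" using finF by simp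
    show "\<rho> {} = 0" by (simp add: \<rho>_def fibre_def corank_def)
    show "\<rho> A \<le> \<rho> B" if "A \<subseteq> B" "B \<subseteq> F \<times> {..<d}" for A B
      unfolding \<rho>_def using that fib by (intro sum_mono corank_mono) (auto simp: fibre_def)
    show "\<rho> (A \<union> B) + \<rho> (A \<inter> B) \<le> \<rho> A + \<rho> B"
      if "A \<subseteq> F \<times> {..<d}" "B \<subseteq> F \<times> {..<d}" for A B
    proof -
      have "fibre (A \<union> B) j = fibre A j \<union> fibre B j"
        "fibre (A \<inter> B) j = fibre A j \<inter> fibre B j" for j
        by (auto simp: fibre_def)
      then show ?thesis
        unfolding \<rho>_def sum.distrib[symmetric]
        using corank_submodular[OF fib[OF that(1)] fib[OF that(2)]] by (auto intro!: sum_mono)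
    qed
    show "S f \<subseteq> F \<times> {..<d}" if "f \<in> F" for f
      using that by (auto simp: S_def)
    fix J assume J: "J \<subseteq> F"
    have "fibre (\<Union>f\<in>J. S f) j = J" if "j < d" for j
      using that by (auto simp: fibre_def S_def)
    then have \<rho>J: "\<rho> (\<Union>f\<in>J. S f) = d * corank J" by (simp add: \<rho>_def)
    have "rank (F - J) \<le> rank F" using F by (intro rank_mono) auto
    then have "corank J + (rank F - rank (F - J)) = card J"
      using corank_add[OF J] by linarith
    then have "d * corank J + d * (rank F - rank (F - J)) = d * card J"
      by (metis distrib_left)
    moreover have "d * card J = (d - 1) * card J + card J"
      using d by (cases d) auto
    ultimately show "card J \<le> \<rho> (\<Union>f\<in>J. S f)"
      using le[OF J] \<rho>J by linarith
  qed (rule finF)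
  then obtain s where sS: "\<And>f. f \<in> F \<Longrightarrow> s f \<in> S f" and s\<rho>: "card F \<le> \<rho> (s ` F)" by blast
  define i where "i f = snd (s f)" for f
  have s_eq: "s f = (f, i f)" and i_less: "i f < d" if "f \<in> F" for f
    using sS[OF that] by (auto simp: S_def i_def mem_Times_iff prod_eq_iff)
  define X where "X j = {f \<in> F. i f = j}" for j
  have "fibre (s ` F) j = X j" for j
    using s_eq by (auto simp: fibre_def X_def image_iff)
  then have \<rho>X: "\<rho> (s ` F) = (\<Sum>j<d. corank (X j))" by (simp add: \<rho>_def)
  have XF: "X j \<subseteq> F" for j by (auto simp: X_def)
  have "F = (\<Union>j<d. X j)" using i_less by (auto simp: X_def)
  moreover have "card (\<Union>j<d. X j) = (\<Sum>j<d. card (X j))"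
    using finF by (intro card_UN_disjoint) (auto simp: X_def)
  ultimately have cardF: "card F = (\<Sum>j<d. card (X j))" by simp
  have corank_le: "corank A \<le> card A" for A
  proof -
    have "rank (F - A) \<le> rank F" using F by (intro rank_mono) auto
    then show ?thesis by (simp add: corank_def)
  qed
  \<comment> \<open>The classes partition \<open>F\<close> and coranks are at most sizes, so Rado's
    bound makes every class independent in the dual.\<close>
  have "(\<Sum>j<d. corank (X j)) = (\<Sum>j<d. card (X j))"
    using s\<rho> \<rho>X cardF sum_mono[of "{..<d}" "\<lambda>j. corank (X j)" "\<lambda>j. card (X j)"] corank_le
    by (intro antisym) auto
  then have corankX: "corank (X j) = card (X j)" if "j < d" for j
    using that sum_mono_inv[of "\<lambda>j. corank (X j)" "{..<d}" "\<lambda>j. card (X j)" j] corank_le by auto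
  have "(src f, tgt f) \<in> conn {g \<in> F. i g \<noteq> i f}" if "f \<in> F" for f
  proof -
    have "rank F \<le> rank (F - X (i f))"
      using corank_add[OF XF, of "i f"] corankX[OF i_less[OF that]] by simp
    then have "(src f, tgt f) \<in> conn (F - X (i f))"
      using F that by (intro connected_if_rank_eq[of _ F]) auto
    moreover have "F - X (i f) = {g \<in> F. i g \<noteq> i f}" by (auto simp: X_def)
    ultimately show ?thesis by simp
  qed
  then show ?thesis using i_less by blast
qed

text \<open>\<open>F\<close> is a violating set of least size. For a nonempty proper subset
  \<open>A\<close> the set \<open>F - A\<close> satisfies the strict count, and comparison with the
  violation by \<open>F\<close> leaves the bound for \<open>A\<close>.\<close>

lemma ex_minimal_violation:
  assumes "\<not> sparse d"
  shows "\<exists>F\<subseteq>E. F \<noteq> {} \<and> (\<forall>A\<subseteq>F. d * (rank F - rank (F - A)) \<le> (d - 1) * card A)"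
proof -
  define Viol where "Viol F \<longleftrightarrow> F \<subseteq> E \<and> F \<noteq> {} \<and> d * rank F \<le> (d - 1) * card F" for F
  have "\<exists>F. Viol F" using assms by (auto simp: sparse_def Viol_def not_less)
  then obtain F where F: "Viol F" and min: "\<And>A. Viol A \<Longrightarrow> card F \<le> card A"
    using ex_has_least_nat[of Viol _ card] by metis
  have finF: "finite F" using F finite_edge_set by (auto simp: Viol_def)
  have "d * (rank F - rank (F - A)) \<le> (d - 1) * card A" if A: "A \<subseteq> F" for A
  proof -
    consider "A = {}" | "A = F" | "A \<noteq> {}" "F - A \<noteq> {}" using A by blast
    then show ?thesis
    proof cases
      case 3
      have finA: "finite A" using finite_subset[OF A finF] .
      have "card (F - A) < card F" using 3 A finF by (intro psubset_card_mono) auto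
      then have "\<not> Viol (F - A)" using min[of "F - A"] by auto
      then have "(d - 1) * card (F - A) < d * rank (F - A)"
        using 3 F by (auto simp: Viol_def)
      moreover have "card F = card A + card (F - A)"
        using A finF finA by (simp add: card_Diff_subset card_mono)
      then have "(d - 1) * card F = (d - 1) * card A + (d - 1) * card (F - A)"
        by (simp add: distrib_left)
      moreover have "d * rank F \<le> (d - 1) * card F" using F by (simp add: Viol_def)
      ultimately show ?thesis by (simp add: diff_mult_distrib2)
    qed (use F in \<open>auto simp: Viol_def\<close>)
  qed
  then show ?thesis using F by (auto simp: Viol_def)
qed

text \<open>Row \<open>f\<close> of the matrix is the relation expressing the difference across
  \<open>f\<close> through edges of other classes, read in coordinate \<open>i f\<close>. A
  realisation supplies a nonzero kernel vector, so the determinant vanishes on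
  \<open>direction_image\<close>; at the coordinate directions the matrix is the identity.\<close>

lemma not_parallel_independent:
  assumes "\<not> sparse d" and d: "d > 0"
  shows "\<not> parallel_independent d G"
proof
  assume indep: "parallel_independent d G"
  obtain F where F: "F \<subseteq> E" "F \<noteq> {}"
    and le: "\<And>A. A \<subseteq> F \<Longrightarrow> d * (rank F - rank (F - A)) \<le> (d - 1) * card A"
    using ex_minimal_violation[OF assms(1)] by blast
  obtain i where "\<And>f. f \<in> F \<Longrightarrow> i f < d"
    and conn: "\<And>f. f \<in> F \<Longrightarrow> (src f, tgt f) \<in> conn {g \<in> F. i g \<noteq> i f}"
    using ex_cobasis_covering[OF F(1) le d] by blast
  \<comment> \<open>Edges outside \<open>F\<close> need some coordinate direction as well; 0 is an
    admissible index as \<open>d > 0\<close>.\<close>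
  define i' where "i' f = (if f \<in> F then i f else 0)" for f
  have i': "i' f < d" for f using \<open>\<And>f. f \<in> F \<Longrightarrow> i f < d\<close> d by (auto simp: i'_def)
  have "\<forall>f. \<exists>c :: 'e \<Rightarrow> complex. f \<in> F \<longrightarrow> (\<forall>p :: 'v \<Rightarrow> complex. p (src f) - p (tgt f) =
      (\<Sum>g | g \<in> F \<and> i g \<noteq> i f. c g * (p (src g) - p (tgt g))))"
  proof (intro allI)
    fix f
    show "\<exists>c :: 'e \<Rightarrow> complex. f \<in> F \<longrightarrow> (\<forall>p :: 'v \<Rightarrow> complex. p (src f) - p (tgt f) =
      (\<Sum>g | g \<in> F \<and> i g \<noteq> i f. c g * (p (src g) - p (tgt g))))"
    proof (cases "f \<in> F")
      case True
      have "{g \<in> F. i g \<noteq> i f} \<subseteq> E" using F by auto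
      from potential_difference_in_span[OF this conn[OF True]] show ?thesis by blast
    qed auto
  qed
  from choice[OF this] obtain c :: "'e \<Rightarrow> 'e \<Rightarrow> complex" where c: "\<forall>f. f \<in> F \<longrightarrow>
      (\<forall>p :: 'v \<Rightarrow> complex. p (src f) - p (tgt f) =
      (\<Sum>g | g \<in> F \<and> i g \<noteq> i f. c f g * (p (src g) - p (tgt g))))" by (elim exE)
  note c = c[rule_format]
  define a where "a f g = (if g = f then 1 else if i g \<noteq> i f then - c f g else 0)" for f g
  define m where "m f g j = (if j = i f then a f g else 0)" for f g j
  have m: "(\<Sum>j<d. m f g j * x (g, j)) = a f g * x (g, i f)" if "f \<in> F" for f g x
    using \<open>\<And>f. f \<in> F \<Longrightarrow> i f < d\<close>[OF that] by (simp add: m_def if_distrib[of "\<lambda>x. x * _"] cong: if_cong)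
  from ex_determinantal_cpoly[OF finite_edge_set[OF F(1)] F(1), of d m]
  obtain D where D: "multihomogeneous d E D" and evalD: "\<And>x. eval_cpoly D x \<noteq> 0 \<longleftrightarrow>
    (\<forall>t. (\<forall>f\<in>F. (\<Sum>g\<in>F. (\<Sum>j<d. m f g j * x (g, j)) * t g) = 0) \<longrightarrow> (\<forall>g\<in>F. t g = 0))"
    by blast
  have finF: "finite F" by (rule finite_edge_set[OF F(1)])
  have sub: "direction_image d G \<subseteq> proj_power d E" by (auto simp: direction_image_def)
  have "direction_image d G \<subseteq> zero_locus d E {D}"
  proof
    fix L assume L: "L \<in> direction_image d G"
    then obtain p where LP: "L \<in> proj_power d E" and pV: "p ` V \<subseteq> carrier_vec d"
      and dir: "\<And>e. e \<in> E \<Longrightarrow> L e = proj_class (p (src e) - p (tgt e))"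
      using ends_eq by (auto simp: direction_image_def)
    have "eval_cpoly D (\<lambda>(e, j). x e $ j) = 0" if x: "\<And>e. e \<in> E \<Longrightarrow> x e \<in> L e" for x
    proof -
      have "\<forall>e. \<exists>\<gamma>. e \<in> E \<longrightarrow> \<gamma> \<noteq> 0 \<and> x e = \<gamma> \<cdot>\<^sub>v (p (src e) - p (tgt e))"
        using x dir unfolding proj_class_def by blast
      then obtain \<gamma> where \<gamma>: "\<And>e. e \<in> E \<Longrightarrow> \<gamma> e \<noteq> 0"
        and xe: "\<And>e. e \<in> E \<Longrightarrow> x e = \<gamma> e \<cdot>\<^sub>v (p (src e) - p (tgt e))" by metis
      have xj: "x e $ j * (1 / \<gamma> e) = p (src e) $ j - p (tgt e) $ j" if "e \<in> E" "j < d" for e j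
      proof -
        have "p (src e) \<in> carrier_vec d" "p (tgt e) \<in> carrier_vec d" using that pV by auto
        then show ?thesis using that \<gamma> by (simp add: xe)
      qed
      \<comment> \<open>Multiplied by \<open>1 / \<gamma> g\<close>, the representative
        \<open>x g\<close> is the difference of the end points, whatever homogeneous coordinates
        were chosen; so the reciprocals solve every row.\<close>
      have kernel: "(\<Sum>g\<in>F. (\<Sum>j<d. m f g j * (case (g, j) of (e, j) \<Rightarrow> x e $ j)) * (1 / \<gamma> g)) = 0"
        if f: "f \<in> F" for f
      proof -
        let ?\<delta> = "\<lambda>g. p (src g) $ i f - p (tgt g) $ i f"
        have "(\<Sum>g\<in>F. (\<Sum>j<d. m f g j * (case (g, j) of (e, j) \<Rightarrow> x e $ j)) * (1 / \<gamma> g)) =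
          (\<Sum>g\<in>F. a f g * ?\<delta> g)"
        proof (rule sum.cong)
          fix g assume g: "g \<in> F"
          have "(\<Sum>j<d. m f g j * (case (g, j) of (e, j) \<Rightarrow> x e $ j)) * (1 / \<gamma> g) =
            a f g * (x g $ i f * (1 / \<gamma> g))"
            using m[OF f, of g "\<lambda>(e, j). x e $ j"] by simp
          then show "(\<Sum>j<d. m f g j * (case (g, j) of (e, j) \<Rightarrow> x e $ j)) * (1 / \<gamma> g) = a f g * ?\<delta> g"
            using xj[of g "i f"] g f F i'[of f] by (simp only: i'_def if_True subset_iff)
        qed simp
        also have "\<dots> = (\<Sum>g\<in>F. (if g = f then ?\<delta> g else 0) - (if i g \<noteq> i f then c f g * ?\<delta> g else 0))"
          by (intro sum.cong) (auto simp: a_def)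
        also have "\<dots> = ?\<delta> f - (\<Sum>g | g \<in> F \<and> i g \<noteq> i f. c f g * ?\<delta> g)"
          using finF f by (simp add: sum_subtractf sum.inter_filter)
        also have "\<dots> = 0" using c[OF f, of "\<lambda>v. p v $ i f"] by simp
        finally show ?thesis .
      qed
      obtain f where f: "f \<in> F" using F by auto
      then have \<gamma>f: "1 / \<gamma> f \<noteq> 0" using \<gamma> F by auto
      show ?thesis
      proof (rule ccontr)
        assume "eval_cpoly D (\<lambda>(e, j). x e $ j) \<noteq> 0"
        from evalD[THEN iffD1, OF this, THEN spec, of "\<lambda>g. 1 / \<gamma> g"] show False
          using kernel f \<gamma>f by blast
      qed
    qed
    then show "L \<in> zero_locus d E {D}" using LP by (auto simp: zero_locus_def)
  qed
  then have "proj_power d E \<subseteq> zero_locus d E {D}"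
    using indep D sub zariski_dense_iff[OF sub] by (auto simp: parallel_independent_def)
  moreover define L where "L = (\<lambda>e\<in>E. proj_class (unit_vec d (i' e) :: complex vec))"
  have "unit_vec d j \<noteq> 0\<^sub>v d" if "j < d" for j
    using that by (metis index_unit_vec(1) index_zero_vec(1) zero_neq_one)
  then have "L \<in> proj_power d E"
    using i' by (auto simp: L_def proj_power_def proj_of_def)
  ultimately have "L \<in> zero_locus d E {D}" by blast
  then have "eval_cpoly D (\<lambda>(e, j). unit_vec d (i' e) $ j) = 0"
    by (auto simp: zero_locus_def L_def proj_class_self)
  moreover have "eval_cpoly D (\<lambda>(e, j). unit_vec d (i' e) $ j) \<noteq> 0"
    unfolding evalD
  proof (intro allI impI ballI)
    fix t f assume t: "\<forall>f\<in>F. (\<Sum>g\<in>F. (\<Sum>j<d. m f g j *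
      (case (g, j) of (e, j) \<Rightarrow> unit_vec d (i' e) $ j)) * t g) = 0" and f: "f \<in> F"
    have "(\<Sum>g\<in>F. (\<Sum>j<d. m f g j * (case (g, j) of (e, j) \<Rightarrow> unit_vec d (i' e) $ j)) * t g) =
      (\<Sum>g\<in>F. if g = f then t g else 0)"
    proof (rule sum.cong)
      fix g assume g: "g \<in> F"
      \<comment> \<open>If \<open>i g \<noteq> i f\<close>, the unit vector of \<open>g\<close> is
        zero in coordinate \<open>i f\<close>; if \<open>i g = i f\<close>, the coefficient
        \<open>a f g\<close> is zero unless \<open>g = f\<close>.\<close>
      show "(\<Sum>j<d. m f g j * (case (g, j) of (e, j) \<Rightarrow> unit_vec d (i' e) $ j)) * t g =
        (if g = f then t g else 0)"
        unfolding m[OF f, of g "\<lambda>(e, j). unit_vec d (i' e) $ j"]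
        using g f i'[of f] i'[of g] by (auto simp: a_def i'_def)
    qed simp
    then show "t f = 0" using t f finF by simp
  qed
  ultimately show False by contradiction
qed

end

subsection \<open>Density of the realisable directions\<close>

context oriented_multigraph
begin

lemma no_loop_if_sparse:
  assumes sparse: "sparse d" and e: "e \<in> E"
  shows "src e \<noteq> tgt e"
proof
  assume eq: "src e = tgt e"
  then have "(src e, tgt e) \<in> conn {}" using conn_refl[of "{}" "src e"] e by simp
  then have "rank {e} = 0" using rank_insert[of "{}" e] e by simp
  moreover have "(d - 1) * card {e} < d * rank {e}" using sparse e unfolding sparse_def by blast
  ultimately show False by simp
qed

text \<open>The identity principle is used twice: in the positions \<open>p\<close>, to remove the
  injectivity assumption, and in the directions \<open>x\<close>, to pass from realisable ones to
  all. In between, scaling turns the differences \<open>t e * x (e, j)\<close> of a realisation back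
  into \<open>x\<close>.\<close>

lemma eval_cpoly_zero_if_zero_on_realisable:
  assumes sparse: "sparse d" and d: "d > 0" and f: "multihomogeneous d E f"
    and zero: "\<And>p :: 'v \<times> nat \<Rightarrow> complex. inj_on (\<lambda>v. p (v, 0)) V \<Longrightarrow>
      eval_cpoly f (\<lambda>(e, j). p (src e, j) - p (tgt e, j)) = 0"
  shows "eval_cpoly f x = 0"
proof -
  let ?\<delta> = "\<lambda>(p :: 'v \<times> nat \<Rightarrow> complex) (e, j). p (src e, j) - p (tgt e, j)"
  have zero': "eval_cpoly f (?\<delta> p) = 0" for p
  proof -
    \<comment> \<open>Injectivity of the 0-th coordinate means avoiding finitely many hyperplanes,
      one for each pair of distinct vertices.\<close>
    define I where "I = V \<times> V - Id"
    define U :: "'v \<times> 'v \<Rightarrow> ('v \<times> nat \<Rightarrow> complex) set" where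
      "U = (\<lambda>(u, w). {p. p (u, 0) - p (w, 0) \<noteq> 0})"
    have U: "line_open (\<Inter>k\<in>I. U k) \<and> (\<Inter>k\<in>I. U k) \<noteq> {}"
    proof (rule line_open_INT)
      show "finite I" by (simp add: I_def)
      fix k assume "k \<in> I"
      then obtain u w where k: "k = (u, w)" "u \<noteq> w" by (auto simp: I_def)
      show "line_open (U k)"
        unfolding k U_def prod.case by (rule line_open_linear_nonzero) (simp add: algebra_simps)
      have "(\<lambda>(v, j). if v = u then 1 else 0) \<in> U k"
        using k by (simp add: U_def)
      then show "U k \<noteq> {}" by auto
    qed
    show ?thesis
    proof (rule eval_cpoly_zero_if_zero_on_line_open[where T = ?\<delta> and U = "\<Inter>k\<in>I. U k"])
      show "?\<delta> (\<lambda>i. x i + s * y i) = (\<lambda>i. ?\<delta> x i + s * ?\<delta> y i)" for x y s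
        by (auto simp: fun_eq_iff algebra_simps)
      fix p assume p: "p \<in> (\<Inter>k\<in>I. U k)"
      have "inj_on (\<lambda>v. p (v, 0)) V"
        using p by (force simp: inj_on_def I_def U_def)
      then show "eval_cpoly f (?\<delta> p) = 0" by (rule zero)
    qed (use U in auto)
  qed
  obtain W where W: "line_open W" "W \<noteq> {}" and
    real: "\<forall>x\<in>W. \<exists>(p :: 'v \<Rightarrow> nat \<Rightarrow> complex) t. (\<forall>f\<in>E. t f \<noteq> 0) \<and>
    (\<forall>f\<in>E. \<forall>j<d. p (src f) j - p (tgt f) j = t f * x (f, j))"
    using ex_line_open_realisable[OF sparse d] by (elim exE conjE)
  from eval_cpoly_scale[OF f finite_E] obtain m where scale:
    "\<forall>t x. eval_cpoly f (\<lambda>(e, j). t e * x (e, j)) = (\<Prod>e\<in>E. t e ^ m e) * eval_cpoly f x"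
    by (elim exE)
  show ?thesis
  proof (rule eval_cpoly_zero_if_zero_on_line_open[where T = "\<lambda>x. x" and U = W])
    fix x assume "x \<in> W"
    from bspec[OF real this] obtain p :: "'v \<Rightarrow> nat \<Rightarrow> complex" and t where t: "\<forall>f\<in>E. t f \<noteq> 0"
      and p: "\<forall>f\<in>E. \<forall>j<d. p (src f) j - p (tgt f) j = t f * x (f, j)"
      by (elim exE conjE)
    have "0 = eval_cpoly f (?\<delta> (\<lambda>(v, j). p v j))" by (simp only: zero')
    also have "\<dots> = eval_cpoly f (\<lambda>(e, j). t e * x (e, j))"
      using p by (intro eval_cpoly_cong[OF f]) auto
    also have "\<dots> = (\<Prod>e\<in>E. t e ^ m e) * eval_cpoly f x" using scale by blast
    finally show "eval_cpoly f x = 0" using t by simp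
  qed (use W in auto)
qed

text \<open>Distinct 0-th coordinates make the points distinct and the differences across edges
  nonzero.\<close>

lemma direction_imageI:
  fixes p :: "'v \<times> nat \<Rightarrow> complex"
  assumes d: "d > 0" and loops: "\<And>e. e \<in> E \<Longrightarrow> src e \<noteq> tgt e"
    and inj: "inj_on (\<lambda>v. p (v, 0)) V"
  shows "(\<lambda>e\<in>E. proj_class (vec d (\<lambda>j. p (src e, j)) - vec d (\<lambda>j. p (tgt e, j)))) \<in> direction_image d G"
    (is "?L \<in> _")
proof -
  let ?q = "\<lambda>v. vec d (\<lambda>j. p (v, j))"
  have "?q (src e) - ?q (tgt e) \<noteq> 0\<^sub>v d" if "e \<in> E" for e
  proof
    assume "?q (src e) - ?q (tgt e) = 0\<^sub>v d"
    then have "(?q (src e) - ?q (tgt e)) $ 0 = 0" using d by simp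
    then have "p (src e, 0) = p (tgt e, 0)" using d by simp
    then show False using inj loops[OF that] that by (auto simp: inj_on_def)
  qed
  then have "?L \<in> proj_power d E"
    by (auto simp: proj_power_def proj_of_def)
  moreover have "inj_on ?q V"
  proof (rule inj_onI)
    fix u w assume uw: "u \<in> V" "w \<in> V" "?q u = ?q w"
    then have "?q u $ 0 = ?q w $ 0" by (simp only:)
    then have "p (u, 0) = p (w, 0)" using d by simp
    then show "u = w" using inj uw by (auto simp: inj_on_def)
  qed
  moreover have "?L e = proj_class (?q v - ?q w)" if e: "e \<in> E" "ends G e = Upair v w" for e v w
  proof -
    have "v = src e \<and> w = tgt e \<or> v = tgt e \<and> w = src e" using e ends_eq[of e] by auto
    moreover have "?q (tgt e) - ?q (src e) = - (?q (src e) - ?q (tgt e))" by auto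
    ultimately show ?thesis using e proj_class_uminus by auto
  qed
  ultimately show ?thesis
    unfolding direction_image_def by (intro CollectI conjI exI[of _ ?q]) auto
qed

lemma parallel_independent_if_sparse:
  assumes sparse: "sparse d" and d: "d > 0"
  shows "parallel_independent d G"
proof -
  have loops: "src e \<noteq> tgt e" if "e \<in> E" for e
    using no_loop_if_sparse[OF sparse that] .
  have sub: "direction_image d G \<subseteq> proj_power d E" by (auto simp: direction_image_def)
  have "zariski_dense d E (direction_image d G)"
    unfolding zariski_dense_iff[OF sub]
  proof (intro allI impI, elim conjE)
    fix f assume f: "multihomogeneous d E f" and le: "direction_image d G \<subseteq> zero_locus d E {f}"
    have "eval_cpoly f x = 0" for x
    proof (rule eval_cpoly_zero_if_zero_on_realisable[OF sparse d f])
      fix p :: "'v \<times> nat \<Rightarrow> complex" assume inj: "inj_on (\<lambda>v. p (v, 0)) V"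
      let ?x = "\<lambda>e. vec d (\<lambda>j. p (src e, j)) - vec d (\<lambda>j. p (tgt e, j))"
      have "eval_cpoly f (\<lambda>(e, j). p (src e, j) - p (tgt e, j)) = eval_cpoly f (\<lambda>(e, j). ?x e $ j)"
        by (intro eval_cpoly_cong[OF f]) auto
      also have "\<dots> = 0"
        using subsetD[OF le direction_imageI[OF d loops inj]]
        by (auto simp: zero_locus_def proj_class_self)
      finally show "eval_cpoly f (\<lambda>(e, j). p (src e, j) - p (tgt e, j)) = 0" .
    qed
    then show "proj_power d E \<subseteq> zero_locus d E {f}" by (auto simp: zero_locus_def)
  qed
  moreover have "\<not> loop G e" if "e \<in> E" for e
    using loops[OF that] ends_eq[OF that] by (auto simp: loop_def)
  ultimately show ?thesis by (simp add: parallel_independent_def)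
qed

end

subsection \<open>The specialised Tutte polynomial\<close>

lemma to_fract_power: "to_fract (x ^ n) = to_fract x ^ n"
  by (induction n) simp_all

section \<open>Sums of monic polynomials\<close>

lemma coeff_monic:
  fixes p :: "int poly"
  assumes "lead_coeff p = 1" "degree p \<le> n"
  shows "coeff p n = (if degree p = n then 1 else 0)"
  using assms by (auto simp: coeff_eq_0)

text \<open>In the top degree \<open>n\<close> among the summands, the coefficient of the sum counts
  the summands of degree \<open>n\<close>. This is positive, so the sum has degree \<open>n\<close>;
  it equals 1 exactly when one summand attains \<open>n\<close>.\<close>

lemma sum_monic_eq_degree_iff:
  fixes p :: "'a \<Rightarrow> int poly"
  assumes "finite A" "a \<in> A" and monic: "\<And>x. x \<in> A \<Longrightarrow> lead_coeff (p x) = 1"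
  shows "lead_coeff (sum p A) = 1 \<and> degree (sum p A) = degree (p a) \<longleftrightarrow>
    (\<forall>x\<in>A - {a}. degree (p x) < degree (p a))"
proof
  assume small: "\<forall>x\<in>A - {a}. degree (p x) < degree (p a)"
  have sum: "sum p A = p a + sum p (A - {a})" using assms by (simp add: sum.remove)
  show "lead_coeff (sum p A) = 1 \<and> degree (sum p A) = degree (p a)"
  proof (cases "A - {a} = {}")
    case True
    then show ?thesis using sum monic[OF assms(2)] by (simp add: True)
  next
    case False
    then obtain x where "x \<in> A - {a}" by blast
    then have "0 < degree (p a)" using small by (metis gr_implies_not_zero neq0_conv)
    then have "degree (sum p (A - {a})) < degree (p a)"
      using small by (intro degree_sum_less) auto
    then show ?thesis
      unfolding sum using monic[OF assms(2)] by (simp add: degree_add_eq_left lead_coeff_add_le coeff_eq_0)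
  qed
next
  assume lead: "lead_coeff (sum p A) = 1 \<and> degree (sum p A) = degree (p a)"
  define n where "n = Max ((\<lambda>x. degree (p x)) ` A)"
  have n: "degree (p x) \<le> n" if "x \<in> A" for x
    using that assms(1) by (auto simp: n_def)
  have "n \<in> (\<lambda>x. degree (p x)) ` A" using assms unfolding n_def by (intro Max_in) auto
  then obtain b where b: "b \<in> A" "degree (p b) = n" by auto
  have "coeff (sum p A) n = (\<Sum>x\<in>A. if degree (p x) = n then 1 else 0)"
    unfolding coeff_sum using monic n by (intro sum.cong coeff_monic) auto
  then have coeff_n: "coeff (sum p A) n = int (card {x \<in> A. degree (p x) = n})"
    using assms(1) by (simp add: sum.If_cases Int_def)
  moreover have "card {x \<in> A. degree (p x) = n} > 0"
    using b assms(1) by (auto simp: card_gt_0_iff)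
  ultimately have "n \<le> degree (sum p A)" by (intro le_degree) auto
  then have "n = degree (p a)" using lead n[OF assms(2)] by simp
  then have "card {x \<in> A. degree (p x) = n} = 1" using lead coeff_n by (metis of_nat_1 of_nat_eq_iff)
  moreover have "a \<in> {x \<in> A. degree (p x) = n}" using assms(2) \<open>n = degree (p a)\<close> by simp
  ultimately have "{x \<in> A. degree (p x) = n} = {a}" by (metis card_1_singletonE singletonD)
  then show "\<forall>x\<in>A - {a}. degree (p x) < degree (p a)"
    using n \<open>n = degree (p a)\<close> by (force simp: le_less)
qed

section \<open>Coefficients and recursion of the q-integers\<close>

lemma coeff_q_int: "coeff (q_int m) k = (if k < m then 1 else 0)"
  by (simp add: q_int_def coeff_sum)

lemma degree_q_int: "degree (q_int (Suc m)) = m"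
  by (intro antisym degree_le le_degree) (auto simp: coeff_q_int)

lemma degree_q_int_minus_1:
  assumes "d \<ge> 2"
  shows "degree (q_int d - 1) = d - 1 \<and> lead_coeff (q_int d - 1) = 1"
proof -
  have c: "coeff (q_int d - 1) k = (if 0 < k \<and> k < d then 1 else 0)" for k
    using assms by (simp add: coeff_q_int)
  have "degree (q_int d - 1) = d - 1"
    using assms by (intro antisym degree_le le_degree) (auto simp: c simp del: coeff_diff)
  then show ?thesis using assms by (simp add: c del: coeff_diff)
qed

lemma q_int_Suc_eq: "q_int (Suc m) = [:0, 1:] * q_int m + 1"
  by (intro poly_eqI) (auto simp: coeff_q_int coeff_pCons split: nat.split)

lemma q_int_2: "q_int 2 = [:0, 1:] + 1"
  by (simp add: q_int_def numeral_2_eq_2 monom_Suc one_pCons)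

text \<open>The numerator of \<open>x - 1\<close> over \<open>q_int d - 1\<close>:
  \<open>(1 + q) [d] - [d] + 1 = q [d] + 1 = [d + 1]\<close>.\<close>

lemma q_int_shift: "q_int 2 * q_int d - (q_int d - 1) = q_int (Suc d)"
  unfolding q_int_2 q_int_Suc_eq by (simp add: algebra_simps)

context oriented_multigraph
begin

text \<open>The expression of the theorem with denominators cleared term by term, hence a polynomial
  with integer coefficients by construction.\<close>

definition tutte_poly :: "nat \<Rightarrow> int poly" where
  "tutte_poly d = (\<Sum>F\<in>Pow E. q_int (Suc d) ^ (rank E - rank F) * (q_int d - 1) ^ card F)"

text \<open>In the term of \<open>F\<close> the exponents of \<open>q_int d - 1\<close> add up to
  \<open>rank E - (rank E - rank F) + (card F - rank F) = card F\<close>.\<close>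

lemma to_fract_tutte_poly:
  assumes "d \<ge> 2"
  shows "to_fract (tutte_poly d) = to_fract (q_int d - 1) ^ rank E *
    tutte G (to_fract (q_int 2 * q_int d) / to_fract (q_int d - 1)) (to_fract (q_int d))"
proof -
  define D N where "D = to_fract (q_int d - 1)" and "N = to_fract (q_int (Suc d))"
  have "q_int d - 1 \<noteq> 0" using degree_q_int_minus_1[OF assms] by (metis coeff_0 zero_neq_one)
  then have D: "D \<noteq> 0" unfolding D_def by (simp only: to_fract_eq_0_iff) simp
  have "to_fract (q_int 2 * q_int d) = N + D"
    unfolding N_def D_def to_fract_add[symmetric] q_int_shift[symmetric] by simp
  then have x: "to_fract (q_int 2 * q_int d) / D - 1 = N / D"
    using D by (simp add: field_simps)
  have y: "to_fract (q_int d) - 1 = D" by (simp add: D_def)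
  have "D ^ rank E * ((N / D) ^ (rank E - rank F) * D ^ (card F - rank F)) =
    N ^ (rank E - rank F) * D ^ card F" if F: "F \<subseteq> E" for F
  proof -
    have r: "rank F \<le> rank E" "rank F \<le> card F"
      using F by (auto intro: rank_mono rank_le_card)
    have "D ^ rank E = D ^ (rank E - rank F) * D ^ rank F"
      using r by (simp add: power_add[symmetric])
    moreover have "D ^ card F = D ^ rank F * D ^ (card F - rank F)"
      using r by (simp add: power_add[symmetric])
    ultimately show ?thesis using D by (simp add: power_divide)
  qed
  then have "(\<Sum>F\<in>Pow E. D ^ rank E * ((N / D) ^ (rank E - rank F) * D ^ (card F - rank F))) =
    to_fract (tutte_poly d)"
    unfolding tutte_poly_def N_def D_def
    by (simp only: to_fract_sum to_fract_mult to_fract_power)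
      (intro sum.cong; simp)
  then show ?thesis
    unfolding tutte_def D_def[symmetric] x y sum_distrib_left by (simp add: graph_rank_eq)
qed

text \<open>The term of the empty set has the required degree \<open>d * rank E\<close>; the term of
  \<open>F\<close> stays below it exactly when \<open>F\<close> satisfies the strict count.\<close>

lemma tutte_poly_monic_iff:
  assumes d: "d \<ge> 2"
  shows "lead_coeff (tutte_poly d) = 1 \<and> degree (tutte_poly d) = d * rank E \<longleftrightarrow> sparse d"
proof -
  let ?p = "\<lambda>F. q_int (Suc d) ^ (rank E - rank F) * (q_int d - 1) ^ card F"
  have N: "lead_coeff (q_int (Suc d)) = 1" by (simp add: degree_q_int coeff_q_int)
  have D: "lead_coeff (q_int d - 1) = 1" "degree (q_int d - 1) = d - 1"
    using degree_q_int_minus_1[OF d] by auto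
  have nz: "q_int (Suc d) \<noteq> 0" "q_int d - 1 \<noteq> 0"
    using N D(1) by (metis coeff_0 zero_neq_one)+
  have monic: "lead_coeff (?p F) = 1" for F
    using N D(1) by (simp only: lead_coeff_mult lead_coeff_power) simp
  have degree: "degree (?p F) = d * (rank E - rank F) + (d - 1) * card F" for F
  proof -
    have "degree (q_int (Suc d) ^ k) = d * k" "degree ((q_int d - 1) ^ k) = (d - 1) * k" for k
      by (simp_all only: degree_power_eq[OF nz(1)] degree_power_eq[OF nz(2)] D(2) degree_q_int mult.commute)
    moreover have "q_int (Suc d) ^ (rank E - rank F) \<noteq> 0" "(q_int d - 1) ^ card F \<noteq> 0"
      using nz by (auto simp del: right_minus_eq)
    ultimately show ?thesis by (simp add: degree_mult_eq)
  qed
  have "lead_coeff (sum ?p (Pow E)) = 1 \<and> degree (sum ?p (Pow E)) = degree (?p {}) \<longleftrightarrow>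
    (\<forall>F\<in>Pow E - {{}}. degree (?p F) < degree (?p {}))"
    using monic by (intro sum_monic_eq_degree_iff) auto
  also have "\<dots> \<longleftrightarrow> sparse d"
  proof -
    have "d * (rank E - rank F) + (d - 1) * card F < d * rank E \<longleftrightarrow> (d - 1) * card F < d * rank F"
      if "F \<subseteq> E" for F
    proof -
      have "d * rank F \<le> d * rank E" using rank_mono[OF that] by simp
      then show ?thesis unfolding diff_mult_distrib2 by linarith
    qed
    then show ?thesis unfolding degree sparse_def by auto
  qed
  finally show ?thesis unfolding tutte_poly_def degree by simp
qed

end

theorem theorem14:
  fixes G :: "('v, 'e) multigraph" and d :: nat
  assumes "finite_multigraph G" and "d \<ge> 2"
  shows "\<exists>P :: int poly.
           to_fract P =
             to_fract (q_int d - 1) ^ (num_verts G - num_components G) *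
             tutte G (to_fract (q_int 2 * q_int d) / to_fract (q_int d - 1)) (to_fract (q_int d)) \<and>
           (parallel_independent d G \<longleftrightarrow>
              lead_coeff P = 1 \<and> degree P = d * (num_verts G - num_components G))"
proof -
  obtain src tgt where ends: "\<And>e. ends G e = Upair (src e) (tgt e)"
  proof -
    have "\<exists>a b. ends G e = Upair a b" for e by (cases "ends G e") auto
    then show ?thesis using that by metis
  qed
  interpret oriented_multigraph G src tgt
    using assms(1) ends by unfold_locales auto
  have "parallel_independent d G \<longleftrightarrow> sparse d"
    using parallel_independent_if_sparse[of d] not_parallel_independent[of d] assms(2) by auto
  then show ?thesis
    using to_fract_tutte_poly[OF assms(2)] tutte_poly_monic_iff[OF assms(2)]
    unfolding rank_E by (intro exI[of _ "tutte_poly d"]) blast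
qed

end
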